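(* Let $G$ be a connected graph with vertex set $\{x_1,\ldots,x_n\}$, let $A$ be its incidence matrix with column vectors $v_1,\ldots,v_q$, let $K$ be a field, let $R=K[x_1,\ldots,x_n]$ be a polynomial ring over $K$, and let $t$ be a new variable. Then the following conditions (a)--(d) are equivalent to each other, and the system $x\geq 0;\ xA\leq\mathbf{1}$ has the integer rounding property if and only if any of them holds: (a) the system $x\geq 0;\ xA\geq\mathbf{1}$ has the integer rounding property; (b) the Rees algebra $R[It]$ is a normal domain, where $I=I(G)$ is the edge ideal of $G$; (c) the subring $K[x^{v_1}t,\ldots,x^{v_q}t]$ of $R[t]$ is normal; (d) the subring $K[t,x_1t,\ldots,x_nt,x^{v_1}t,\ldots,x^{v_q}t]$ of $R[t]$ is normal.
   Context: Graphs are finite and simple, and have no isolated vertices (each vertex occurs in at least one edge). If $G$ has vertex set $\{x_1,\ldots,x_n\}$ and edges $f_1,\ldots,f_q$, the characteristic vector of $f_k$ is $v_k=\sum_{x_i\in f_k}e_i\in\mathbb{R}^n$, where $e_i$ is the $i$-th unit vector, and the incidence matrix $A$ of $G$ is the $n\times q$ matrix with column vectors $v_1,\ldots,v_q$. The vertices are identified with the variables of $R$. For $a=(a_1,\ldots,a_n)\in\mathbb{N}^n$, $x^a=x_1^{a_1}\cdots x_n^{a_n}$. Inequalities between vectors are entrywise, $\mathbf{1}$ is the vector with all entries equal to $1$, $\langle\ ,\ \rangle$ is the standard inner product, and $\mathbb{N}=\{0,1,2,\ldots\}$. The system $x\geq 0;\ xA\leq\mathbf{1}$ has the integer rounding property if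 $$\lceil\min\{\langle y,\mathbf{1}\rangle \mid y\geq 0;\ Ay\geq \alpha\}\rceil=\min\{\langle y,\mathbf{1}\rangle \mid Ay\geq \alpha;\ y\in\mathbb{N}^q\}$$ for each integral vector $\alpha\in\mathbb{Z}^n$ for which $\min\{\langle y,\mathbf{1}\rangle \mid y\geq 0;\ Ay\geq \alpha\}$ is finite. The system $x\geq 0;\ xA\geq\mathbf{1}$ has the integer rounding property if $$\max\{\langle y,\mathbf{1}\rangle \mid Ay\leq w;\ y\in\mathbb{N}^q\}=\lfloor\max\{\langle y,\mathbf{1}\rangle \mid y\geq 0;\ Ay\leq w\}\rfloor$$ for each integral vector $w\in\mathbb{Z}^n$ for which the right-hand side is finite. (In the maxima and minima without the condition $y\in\mathbb{N}^q$, $y$ ranges over $\mathbb{R}^q$.) The edge ideal $I(G)$ is the ideal of $R$ generated by $x^{v_1},\ldots,x^{v_q}$, and the Rees algebra of $I$ is $R[It]=R\oplus It\oplus\cdots\oplus I^it^i\oplus\cdots\subset R[t]$. A subring that is an integral domain is normal if it is integrally closed in its field of fractions. *)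

theory Defs
  imports
    "HOL-Analysis.Analysis"
    "HOL-Computational_Algebra.Polynomial"
    "HOL-Computational_Algebra.Fraction_Field"
    "HOL-Library.Poly_Mapping"
begin

text \<open>
  The vertices are the elements of a finite type \<open>'n\<close>, and the edges are enumerated without
  repetition by a finite type \<open>'q\<close>.
\<close>

definition simple_graph :: "('q::finite \<Rightarrow> 'n::finite set) \<Rightarrow> bool" where
  "simple_graph f \<longleftrightarrow> inj f \<and> (\<forall>k. card (f k) = 2)"

definition no_isolated_vertices :: "('q::finite \<Rightarrow> 'n::finite set) \<Rightarrow> bool" where
  "no_isolated_vertices f \<longleftrightarrow> (\<forall>i. \<exists>k. i \<in> f k)"

definition connected_graph :: "('q::finite \<Rightarrow> 'n::finite set) \<Rightarrow> bool" where
  "connected_graph f \<longleftrightarrow> (\<forall>i j. (i, j) \<in> {(u, v). \<exists>k. f k = {u, v}}\<^sup>*)"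

text \<open>
  Polymorphic in the entries, since characteristic vectors serve both as columns of a real
  matrix and as exponent vectors of monomials.
\<close>

definition char_vec :: "'n::finite set \<Rightarrow> 'a::zero_neq_one ^ 'n" where
  "char_vec e = (\<chi> i. of_bool (i \<in> e))"

definition incidence_matrix :: "('q::finite \<Rightarrow> 'n::finite set) \<Rightarrow> real ^ 'q ^ 'n" where
  "incidence_matrix f = (\<chi> i k. char_vec (f k) $ i)"

text \<open>
  A minimum (maximum) being finite means that the set of values has a least (greatest) element.
  The order on vectors is the entrywise one, and \<open>1\<close> is the all-ones vector.
\<close>

definition is_min_of :: "real set \<Rightarrow> real \<Rightarrow> bool" where
  "is_min_of S m \<longleftrightarrow> m \<in> S \<and> (\<forall>s\<in>S. m \<le> s)"

definition is_max_of :: "real set \<Rightarrow> real \<Rightarrow> bool" where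
  "is_max_of S m \<longleftrightarrow> m \<in> S \<and> (\<forall>s\<in>S. s \<le> m)"

definition integer_rounding_le_one :: "real ^ 'q::finite ^ 'n::finite \<Rightarrow> bool" where
  "integer_rounding_le_one A \<longleftrightarrow>
     (\<forall>\<alpha> m. (\<forall>i. \<alpha> $ i \<in> \<int>) \<longrightarrow>
        is_min_of {inner y 1 | y. 0 \<le> y \<and> A *v y \<ge> \<alpha>} m \<longrightarrow>
        is_min_of {inner y 1 | y. A *v y \<ge> \<alpha> \<and> (\<forall>k. y $ k \<in> \<nat>)} (of_int \<lceil>m\<rceil>))"

definition integer_rounding_ge_one :: "real ^ 'q::finite ^ 'n::finite \<Rightarrow> bool" where
  "integer_rounding_ge_one A \<longleftrightarrow>
     (\<forall>w m. (\<forall>i. w $ i \<in> \<int>) \<longrightarrow>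
        is_max_of {inner y 1 | y. 0 \<le> y \<and> A *v y \<le> w} m \<longrightarrow>
        is_max_of {inner y 1 | y. A *v y \<le> w \<and> (\<forall>k. y $ k \<in> \<nat>)} (of_int \<lfloor>m\<rfloor>))"

definition is_subring :: "'a::comm_ring_1 set \<Rightarrow> bool" where
  "is_subring S \<longleftrightarrow> 1 \<in> S \<and> (\<forall>a\<in>S. \<forall>b\<in>S. a - b \<in> S \<and> a * b \<in> S)"

text \<open>
  The field of fractions of a subring \<open>S\<close> of a domain is realised inside that of the domain.
\<close>

definition fraction_field_of :: "'a::idom set \<Rightarrow> 'a fract set" where
  "fraction_field_of S = {Fraction_Field.Fract a b | a b. a \<in> S \<and> b \<in> S \<and> b \<noteq> 0}"

definition integral_over :: "'a::comm_ring_1 set \<Rightarrow> 'a \<Rightarrow> bool" where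
  "integral_over S z \<longleftrightarrow> (\<exists>p. lead_coeff p = 1 \<and> (\<forall>i. coeff p i \<in> S) \<and> poly p z = 0)"

definition normal_subring :: "'a::idom set \<Rightarrow> bool" where
  "normal_subring S \<longleftrightarrow> is_subring S \<and>
     (let S' = (\<lambda>a. Fraction_Field.Fract a 1) ` S
      in \<forall>z\<in>fraction_field_of S. integral_over S' z \<longrightarrow> z \<in> S')"

text \<open>
  The ring \<open>R\<close> is the monoid algebra over the exponents \<open>'n \<Rightarrow>\<^sub>0 nat\<close>, and \<open>R[t]\<close> is the type
  \<open>('n, 'k) mpoly poly\<close>. The library's proof that \<open>R\<close> is a domain needs a linear order on \<open>'n\<close>.
\<close>

type_synonym ('n, 'k) mpoly = "('n \<Rightarrow>\<^sub>0 nat) \<Rightarrow>\<^sub>0 'k"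

definition Const :: "'k::field \<Rightarrow> ('n, 'k) mpoly" where
  "Const c = Poly_Mapping.single 0 c"

definition Var :: "'n \<Rightarrow> ('n, 'k::field) mpoly" where
  "Var i = Poly_Mapping.single (Poly_Mapping.single i 1) 1"

definition monomial :: "nat ^ 'n::finite \<Rightarrow> ('n, 'k::field) mpoly" where
  "monomial a = (\<Prod>i\<in>UNIV. Var i ^ (a $ i))"

text \<open>The \<open>K\<close>-subalgebra \<open>K[F]\<close> of \<open>R[t]\<close>.\<close>

definition subalgebra_gen :: "('n, 'k::field) mpoly poly set \<Rightarrow> ('n, 'k) mpoly poly set" where
  "subalgebra_gen F = is_subring hull (range (\<lambda>c. [:Const c:]) \<union> F)"

definition ideal_gen :: "'a::comm_ring_1 set \<Rightarrow> 'a set" where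
  "ideal_gen S = module.span (*) S"

primrec ideal_power :: "'a::comm_ring_1 set \<Rightarrow> nat \<Rightarrow> 'a set" where
  "ideal_power I 0 = UNIV"
| "ideal_power I (Suc n) = ideal_gen {a * b | a b. a \<in> I \<and> b \<in> ideal_power I n}"

definition edge_ideal :: "('q::finite \<Rightarrow> 'n::finite set) \<Rightarrow> ('n, 'k::field) mpoly set" where
  "edge_ideal f = ideal_gen (range (\<lambda>k. monomial (char_vec (f k))))"

definition rees_algebra :: "'a::comm_ring_1 set \<Rightarrow> 'a poly set" where
  "rees_algebra I = {p. \<forall>i. coeff p i \<in> ideal_power I i}"

definition edge_subring_t :: "('q::finite \<Rightarrow> 'n::finite set) \<Rightarrow> ('n, 'k::field) mpoly poly set" where
  "edge_subring_t f = subalgebra_gen (range (\<lambda>k. monom (monomial (char_vec (f k))) 1))"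

definition extended_edge_subring_t ::
    "('q::finite \<Rightarrow> 'n::finite set) \<Rightarrow> ('n, 'k::field) mpoly poly set" where
  "extended_edge_subring_t f = subalgebra_gen
     ({monom 1 1} \<union> range (\<lambda>i. monom (Var i) 1) \<union>
      range (\<lambda>k. monom (monomial (char_vec (f k))) 1))"

end

theory Submission
  imports Defs
begin

text \<open>
  Call a vertex multiset \<open>a\<close> an edge sum if it is a sum of characteristic vectors of edges. For
  a connected graph every one of the five conditions is equivalent to the combinatorial condition
  that \<open>a\<close> is an edge sum whenever \<open>2a\<close> is one and \<open>|a|\<close> is even.

  That condition implies each of the others through a near-integral min-max theorem. Koenig's
  theorem for the bipartite double cover gives, for every \<open>w\<close>, a vertex cover \<open>(X, Y)\<close> and a
  matching \<open>z\<close> of size \<open>w(X) + w(Y)\<close>. After replacing alternate arcs of its paths by two-way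
  arcs, \<open>z\<close> becomes a circulation, and after cutting one odd cycle if necessary its vertex
  multiset \<open>a\<close> has even size and \<open>2a\<close> is an edge sum. So \<open>a\<close> is the sum of \<open>N\<close> edges, with
  \<open>w(X) + w(Y) \<le> 2N + 1\<close>. Covers bound the linear programs by weak duality, so rounding holds;
  being homogeneous in \<open>w\<close>, they also show that the exponent monoids of the three algebras are
  completely integrally closed. A monoid algebra over such a monoid is normal: if \<open>d (p/q)^k\<close>
  lies in it for all \<open>k\<close>, comparing leading exponents shows that the leading term of \<open>p/q\<close> lies
  in it too, and subtracting this term terminates.

  Conversely, if \<open>2a\<close> is a sum of \<open>2b\<close> edges, then half of each edge is an optimal fractional
  solution, and \<open>x^a t^b\<close> is integral over each algebra. It lies in the fraction field; for the
  edge subring this uses connectedness.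
\<close>

subsection \<open>Fractional matchings in graphs\<close>

text \<open>Let \<open>z\<close> be maximum, let \<open>R\<close> be the left vertices that
  alternating paths can free, and let \<open>Y\<close> be its neighbourhood. The cover is
  (\<open>- R\<close>, \<open>Y\<close>): vertices outside \<open>R\<close> are saturated, those of
  \<open>Y\<close> are saturated because otherwise \<open>z\<close> could be augmented, and an arc
  of \<open>z\<close> enters \<open>Y\<close> exactly when it starts in \<open>R\<close>, so each
  arc is counted once.\<close>

lemma koenig_multiset:
  fixes E :: "('a \<times> 'b) set" and w1 :: "'a multiset" and w2 :: "'b multiset"
  obtains z X Y where "set_mset z \<subseteq> E" "image_mset fst z \<subseteq># w1" "image_mset snd z \<subseteq># w2"
    "\<And>u v. (u, v) \<in> E \<Longrightarrow> u \<in> X \<or> v \<in> Y"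
    "size z = size {#u \<in># w1. u \<in> X#} + size {#v \<in># w2. v \<in> Y#}"
proof -
  define feas where "feas z \<longleftrightarrow> set_mset z \<subseteq> E \<and> image_mset fst z \<subseteq># w1 \<and> image_mset snd z \<subseteq># w2" for z
  have bound: "size z \<le> size w1" if "feas z" for z
    using that size_mset_mono[of "image_mset fst z" w1] by (simp add: feas_def)
  have "feas {#}" by (simp add: feas_def)
  then have "\<exists>z. feas z \<and> (\<forall>z'. feas z' \<longrightarrow> size z' \<le> size z)"
    by (rule ex_has_greatest_nat[where b = "Suc (size w1)"]) (simp add: bound less_Suc_eq_le)
  then obtain z where z: "feas z" and max: "\<And>z'. feas z' \<Longrightarrow> size z' \<le> size z"
    by (elim exE conjE) simp
  \<comment> \<open>A good set consists of left vertices that alternating paths staying inside the set can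
    make unsaturated; a maximal one yields the cover.\<close>
  define good where "good R \<longleftrightarrow> R \<subseteq> set_mset w1 \<and> (\<forall>u. count (image_mset fst z) u < count w1 u \<longrightarrow> u \<in> R) \<and>
    (\<forall>p\<in>R. \<exists>z'. set_mset z' \<subseteq> E \<and> add_mset p (image_mset fst z') \<subseteq># w1 \<and> image_mset snd z' = image_mset snd z
       \<and> (\<forall>a b. a \<notin> R \<longrightarrow> count z' (a, b) = count z (a, b)))" for R
  have "good {u. count (image_mset fst z) u < count w1 u}" unfolding good_def
  proof (intro conjI ballI)
    show "{u. count (image_mset fst z) u < count w1 u} \<subseteq> set_mset w1"
      by (auto simp flip: count_greater_zero_iff)
    fix p assume "p \<in> {u. count (image_mset fst z) u < count w1 u}"
    then have "add_mset p (image_mset fst z) \<subseteq># w1"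
      using z unfolding feas_def subseteq_mset_def by (auto simp: Suc_le_eq)
    then show "\<exists>z'. set_mset z' \<subseteq> E \<and> add_mset p (image_mset fst z') \<subseteq># w1 \<and> image_mset snd z' = image_mset snd z
       \<and> (\<forall>a b. a \<notin> {u. count (image_mset fst z) u < count w1 u} \<longrightarrow> count z' (a, b) = count z (a, b))"
      using z unfolding feas_def by blast
  qed auto
  moreover have "\<forall>R. good R \<longrightarrow> card R < Suc (card (set_mset w1))"
    by (simp add: good_def card_mono less_Suc_eq_le)
  ultimately have "\<exists>R. good R \<and> (\<forall>R'. good R' \<longrightarrow> card R' \<le> card R)"
    by (rule ex_has_greatest_nat)
  then obtain R where R: "good R" and Rmax: "\<And>R'. good R' \<Longrightarrow> card R' \<le> card R"
    by (elim exE conjE) simp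
  have finR: "finite R"
    using R finite_subset unfolding good_def by blast
  have closed: "p \<in> R" if "u \<in> R" "(u, v) \<in> E" "(p, v) \<in># z" for u v p
  proof (rule ccontr)
    assume p: "p \<notin> R"
    obtain z' where z': "set_mset z' \<subseteq> E" "add_mset u (image_mset fst z') \<subseteq># w1"
      "image_mset snd z' = image_mset snd z" "\<And>a b. a \<notin> R \<Longrightarrow> count z' (a, b) = count z (a, b)"
      using R \<open>u \<in> R\<close> unfolding good_def by blast
    \<comment> \<open>The last clause of \<open>good\<close> is made for this: freeing
      \<open>u\<close> has not touched the arcs that start outside \<open>R\<close>, so
      (\<open>p\<close>, \<open>v\<close>) is still there and can be exchanged for
      (\<open>u\<close>, \<open>v\<close>), which frees \<open>p\<close>.\<close>
    have "(p, v) \<in># z'"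
      using z'(4)[OF p, of v] that(3) by (metis count_eq_zero_iff)
    then obtain z0 where z0: "z' = add_mset (p, v) z0"
      by (meson multi_member_split)
    let ?z = "add_mset (u, v) z0"
    have "good (insert p R)" unfolding good_def
    proof (intro conjI ballI)
      show "insert p R \<subseteq> set_mset w1"
        using R z that(3) unfolding good_def feas_def
        by (metis fst_conv image_eqI insert_subset mset_subset_eqD set_image_mset)
      show "\<forall>u. count (image_mset fst z) u < count w1 u \<longrightarrow> u \<in> insert p R"
        using R unfolding good_def by blast
      fix r assume "r \<in> insert p R"
      show "\<exists>z'. set_mset z' \<subseteq> E \<and> add_mset r (image_mset fst z') \<subseteq># w1 \<and> image_mset snd z' = image_mset snd z
       \<and> (\<forall>a b. a \<notin> insert p R \<longrightarrow> count z' (a, b) = count z (a, b))"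
      proof (cases "r = p")
        case True
        have "set_mset ?z \<subseteq> E" "add_mset p (image_mset fst ?z) \<subseteq># w1" "image_mset snd ?z = image_mset snd z"
          using z' z0 that(2) by (auto simp: add_mset_commute)
        moreover have "count ?z (a, b) = count z (a, b)" if "a \<notin> insert p R" for a b
          using z'(4)[of a b] that \<open>u \<in> R\<close> z0 by auto
        ultimately show ?thesis unfolding True by blast
      next
        case False
        then show ?thesis using R \<open>r \<in> insert p R\<close> unfolding good_def by (meson insert_iff)
      qed
    qed
    then show False using Rmax[of "insert p R"] p finR by simp
  qed
  define Y where "Y = {v. \<exists>u\<in>R. (u, v) \<in> E}"
  \<comment> \<open>Spare capacity at \<open>v\<close> would end an augmenting path: free
    \<open>u\<close>, then add (\<open>u\<close>, \<open>v\<close>).\<close>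
  have satY: "count (image_mset snd z) v = count w2 v" if "v \<in> Y" for v
  proof (rule ccontr)
    assume "count (image_mset snd z) v \<noteq> count w2 v"
    moreover have "count (image_mset snd z) v \<le> count w2 v"
      using z unfolding feas_def subseteq_mset_def by blast
    ultimately have less: "count (image_mset snd z) v < count w2 v" by simp
    obtain u where u: "u \<in> R" "(u, v) \<in> E" using \<open>v \<in> Y\<close> Y_def by blast
    obtain z' where z': "set_mset z' \<subseteq> E" "add_mset u (image_mset fst z') \<subseteq># w1"
      "image_mset snd z' = image_mset snd z"
      using R \<open>u \<in> R\<close> unfolding good_def by blast
    have "image_mset snd (add_mset (u, v) z') \<subseteq># w2"
      using less z z'(3) unfolding feas_def subseteq_mset_def by (auto simp: Suc_le_eq)
    then have "feas (add_mset (u, v) z')"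
      using u z' unfolding feas_def by simp
    from max[OF this] have "size z' < size z" by simp
    moreover have "size z' = size z" using z'(3) by (metis size_image_mset)
    ultimately show False by simp
  qed
  have satX: "count (image_mset fst z) u = count w1 u" if "u \<notin> R" for u
  proof -
    have "count (image_mset fst z) u \<le> count w1 u"
      using z unfolding feas_def subseteq_mset_def by blast
    moreover have "\<not> count (image_mset fst z) u < count w1 u"
      using R that unfolding good_def by blast
    ultimately show ?thesis by simp
  qed
  have "{#u \<in># w1. u \<in> - R#} = {#u \<in># image_mset fst z. u \<in> - R#}"
    by (rule multiset_eqI) (auto simp: satX)
  then have X: "size {#u \<in># w1. u \<in> - R#} = size {#e \<in># z. fst e \<notin> R#}"
    by (simp add: filter_mset_image_mset)
  have "{#v \<in># w2. v \<in> Y#} = {#v \<in># image_mset snd z. v \<in> Y#}"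
    by (rule multiset_eqI) (auto simp: satY)
  then have "size {#v \<in># w2. v \<in> Y#} = size {#e \<in># z. snd e \<in> Y#}"
    by (simp add: filter_mset_image_mset)
  also have "{#e \<in># z. snd e \<in> Y#} = {#e \<in># z. \<not> fst e \<notin> R#}"
  proof (rule filter_mset_cong[OF refl])
    fix e assume "e \<in># z"
    moreover from this have "e \<in> E" using z unfolding feas_def by blast
    ultimately show "(snd e \<in> Y) = (\<not> fst e \<notin> R)"
      using closed unfolding Y_def by (cases e) auto
  qed
  finally have "size z = size {#u \<in># w1. u \<in> - R#} + size {#v \<in># w2. v \<in> Y#}"
    using arg_cong[OF multiset_partition[of z "\<lambda>e. fst e \<notin> R"], of size] unfolding X size_union by simp
  moreover have "u \<in> - R \<or> v \<in> Y" if "(u, v) \<in> E" for u v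
    using that unfolding Y_def by blast
  ultimately show thesis
    using z unfolding feas_def by (elim conjE) (rule that)
qed

section \<open>Two-way arcs and odd cycles\<close>

definition deg :: "('v \<times> 'v) multiset \<Rightarrow> 'v multiset" where
  "deg M = image_mset fst M + image_mset snd M"

lemma deg_simps [simp]:
  "deg {#} = {#}" "deg (add_mset e M) = add_mset (fst e) (add_mset (snd e) (deg M))"
  "deg (M + N) = deg M + deg N"
  by (auto simp: deg_def)

lemma size_deg [simp]: "size (deg M) = 2 * size M"
  by (simp add: deg_def)

text \<open>Each edge appears as two opposite arcs. Read as a relation between two copies of the
  vertex set, \<open>E\<close> is the bipartite double cover, while \<open>deg\<close> forgets
  orientations and gives the sum of the characteristic vectors of the edges.\<close>

locale adjacency =
  fixes E :: "('v \<times> 'v) set"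
  assumes sym: "(u, v) \<in> E \<Longrightarrow> (v, u) \<in> E" and irrefl: "(u, u) \<notin> E"
begin

text \<open>
  If \<open>u\<close> has more outgoing than incoming arcs, an arc from \<open>u\<close> to \<open>p\<close> is made two-way at the
  expense of an arc leaving \<open>p\<close>; no other arc has to be given up.
\<close>

lemma symmetrize_matching:
  assumes "set_mset z \<subseteq> E" "image_mset fst z \<subseteq># w" "image_mset snd z \<subseteq># w"
  shows "\<exists>c. set_mset c \<subseteq> E \<and> image_mset fst c = image_mset snd c \<and> image_mset fst c \<subseteq># w \<and> size z \<le> size c"
  using assms
proof (induction "size z" arbitrary: z w rule: less_induct)
  case less
  show ?case
  proof (cases "image_mset fst z = image_mset snd z")
    case True
    then show ?thesis using less.prems by blast
  next
    case False
    \<comment> \<open>Both images have the size of \<open>z\<close>, so an inclusion would be an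
      equality; hence some vertex has a surplus of outgoing arcs.\<close>
    then have "\<not> image_mset fst z \<subseteq># image_mset snd z"
      by (metis size_image_mset mset_subset_size nless_le subset_mset.dual_order.not_eq_order_implies_strict)
    then obtain u where u: "count (image_mset snd z) u < count (image_mset fst z) u"
      unfolding subseteq_mset_def by (auto simp: not_le)
    then have "u \<in># image_mset fst z"
      by (metis count_eq_zero_iff not_less_zero)
    then obtain p where "(u, p) \<in># z" by auto
    then obtain z1 where z1: "z = add_mset (u, p) z1" by (meson multi_member_split)
    have up: "(u, p) \<in> E" using less.prems z1 by simp
    then have "u \<noteq> p" using irrefl by blast
    have pw: "p \<in># w" "u \<in># w" using less.prems z1 by (auto dest: mset_subset_eqD)
    obtain z2 where z2: "z2 \<subseteq># z1" "size z \<le> size z2 + 2" "image_mset fst z2 \<subseteq># w - {#u, p#}"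
    proof (cases "p \<in># image_mset fst z1")
      case True
      then obtain q where "(p, q) \<in># z1" by auto
      then obtain z2 where "z1 = add_mset (p, q) z2" by (meson multi_member_split)
      moreover from this have "image_mset fst z2 \<subseteq># w - {#u, p#}"
        using less.prems(2) z1 unfolding subseteq_mset_def
        by (force simp: diff_le_mono2 dest: spec split: if_splits)
      ultimately show thesis using that[of z2] z1 by simp
    next
      case False
      have "image_mset fst z1 \<subseteq># w - {#u, p#}"
        unfolding subseteq_mset_def
      proof
        fix a
        have "count (image_mset fst z) a \<le> count w a"
          using less.prems(2) unfolding subseteq_mset_def by blast
        then show "count (image_mset fst z1) a \<le> count (w - {#u, p#}) a"
          using False \<open>u \<noteq> p\<close> by (cases "a = p") (auto simp: z1 not_in_iff[THEN iffD1])
      qed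
      then show thesis using that[of z1] z1 by simp
    qed
    \<comment> \<open>On the incoming side nothing is given up: removing (\<open>u\<close>,
      \<open>p\<close>) makes room at \<open>p\<close>, and \<open>u\<close> has room because its
      incoming arcs are fewer than its outgoing ones, which \<open>w\<close> bounds.\<close>
    have "image_mset snd z1 \<subseteq># w - {#u, p#}"
      unfolding subseteq_mset_def
    proof
      fix a
      have "count (image_mset snd z) a \<le> count w a"
        "count (image_mset fst z) a \<le> count w a"
        using less.prems(2,3) unfolding subseteq_mset_def by blast+
      then show "count (image_mset snd z1) a \<le> count (w - {#u, p#}) a"
        using u \<open>u \<noteq> p\<close> by (cases "a = u") (auto simp: z1)
    qed
    then have snd2: "image_mset snd z2 \<subseteq># w - {#u, p#}"
      using z2(1) by (meson image_mset_subseteq_mono subset_mset.order_trans)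
    have "size z2 < size z" using z2(1) z1 size_mset_mono by fastforce
    moreover have "set_mset z2 \<subseteq> E" using less.prems(1) z1 z2(1)
      by (metis set_mset_mono mset_subset_eq_add_right order_trans add_mset_add_single union_commute)
    ultimately obtain c where c: "set_mset c \<subseteq> E" "image_mset fst c = image_mset snd c"
        "image_mset fst c \<subseteq># w - {#u, p#}" "size z2 \<le> size c"
      using less.hyps z2(3) snd2 by blast
    let ?c = "add_mset (u, p) (add_mset (p, u) c)"
    have "{#u, p#} \<subseteq># w" using pw \<open>u \<noteq> p\<close>
      by (simp add: insert_subset_eq_iff in_diff_count)
    then have "{#u, p#} + image_mset fst c \<subseteq># w"
      using c(3) by (metis subset_mset.le_diff_conv2 union_commute)
    then have "image_mset fst ?c \<subseteq># w" by simp
    moreover have "image_mset fst ?c = image_mset snd ?c" using c(2) by (simp add: add_mset_commute)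
    ultimately show ?thesis
      using c z2(2) up sym[OF up] by (intro exI[of _ ?c]) auto
  qed
qed

text \<open>
  The first conjunct drops one vertex of an odd cycle. The second is the state of the search for
  this cycle: the arcs walked from \<open>v\<close> to \<open>x\<close> have been removed from a circulation, and every
  other one of them has been kept as a doubled edge.
\<close>

lemma odd_circulation:
  "(image_mset fst z = image_mset snd z \<and> odd (size z) \<and> set_mset z \<subseteq> E \<longrightarrow>
     (\<exists>a M. a \<subseteq># image_mset fst z \<and> set_mset M \<subseteq> E \<and> a + a = deg M \<and> size z = Suc (size a))) \<and>
   (\<forall>x v. x \<noteq> v \<and> add_mset v (image_mset fst z) = add_mset x (image_mset snd z) \<and> even (size z) \<and> set_mset z \<subseteq> E \<longrightarrow>
     (\<exists>a M. a \<subseteq># add_mset v (image_mset fst z) \<and> set_mset M \<subseteq> E \<and> a + a = deg M \<and> size a = size z))"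
proof (induction "size z" arbitrary: z rule: less_induct)
  case less
  show ?case
  proof (intro conjI impI allI; elim conjE)
    assume circ: "image_mset fst z = image_mset snd z" "odd (size z)" "set_mset z \<subseteq> E"
    then have "z \<noteq> {#}" by auto
    then obtain v x z' where z': "z = add_mset (v, x) z'"
      by (metis multiset_cases surj_pair)
    then have "v \<noteq> x" using circ irrefl by auto
    moreover have "add_mset v (image_mset fst z') = add_mset x (image_mset snd z')"
      using circ z' by simp
    moreover have "size z' < size z" "even (size z')" "set_mset z' \<subseteq> E"
      using z' circ by auto
    ultimately obtain a M where "a \<subseteq># add_mset v (image_mset fst z')" "set_mset M \<subseteq> E" "a + a = deg M" "size a = size z'"
      using less.hyps by metis
    then show "\<exists>a M. a \<subseteq># image_mset fst z \<and> set_mset M \<subseteq> E \<and> a + a = deg M \<and> size z = Suc (size a)"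
      using z' by (intro exI[of _ a] exI[of _ M]) auto
  next
    fix x v
    assume st: "x \<noteq> v" "add_mset v (image_mset fst z) = add_mset x (image_mset snd z)"
      "even (size z)" "set_mset z \<subseteq> E"
    then have "x \<in># image_mset fst z"
      by (metis insert_noteq_member)
    then obtain y z1 where z1: "z = add_mset (x, y) z1"
      by (metis (no_types, lifting) imageE multi_member_split prod.collapse set_image_mset)
    have xy: "(x, y) \<in> E" "x \<noteq> y" using st irrefl z1 by auto
    have E1: "set_mset z1 \<subseteq> E" using st z1 by simp
    have st1: "add_mset v (image_mset fst z1) = add_mset y (image_mset snd z1)"
      using st(2) z1 by (simp add: add_mset_commute)
    show "\<exists>a M. a \<subseteq># add_mset v (image_mset fst z) \<and> set_mset M \<subseteq> E \<and> a + a = deg M \<and> size a = size z"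
    proof (cases "y = v")
      case True
      \<comment> \<open>An even closed walk is covered by its doubled edges; the search starts again
        in the odd circulation that remains.\<close>
      then have "image_mset fst z1 = image_mset snd z1" using st1 by simp
      moreover have "size z1 < size z" "odd (size z1)" using z1 st by auto
      ultimately obtain a M where aM: "a \<subseteq># image_mset fst z1" "set_mset M \<subseteq> E" "a + a = deg M" "size z1 = Suc (size a)"
        using less.hyps E1 by metis
      show ?thesis
        using aM xy True z1
        by (intro exI[of _ "add_mset x (add_mset y a)"] exI[of _ "add_mset (x, y) (add_mset (x, y) M)"])
          (auto simp: add_mset_commute)
    next
      case False
      then have "y \<in># image_mset fst z1"
        using st1 by (metis insert_noteq_member)
      then obtain y2 z2 where z2: "z1 = add_mset (y, y2) z2"
        by (metis (no_types, lifting) imageE multi_member_split prod.collapse set_image_mset)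
      have E2: "set_mset z2 \<subseteq> E" using E1 z2 by simp
      have st2: "add_mset v (image_mset fst z2) = add_mset y2 (image_mset snd z2)"
        using st1 z2 by (simp add: add_mset_commute)
      obtain a M where aM: "a \<subseteq># add_mset v (image_mset fst z2)" "set_mset M \<subseteq> E" "a + a = deg M" "size a = size z2"
      proof (cases "y2 = v")
        case True
        \<comment> \<open>An odd closed walk loses only its start \<open>v\<close>; the even
          circulation that remains is kept whole, its own arcs serving as \<open>M\<close>.\<close>
        then have "image_mset fst z2 = image_mset snd z2" using st2 by simp
        then show thesis
          using that[of "image_mset fst z2" z2] E2 by (simp add: deg_def)
      next
        case False
        moreover have "size z2 < size z" "even (size z2)" using z1 z2 st by auto
        ultimately show thesis
          using less.hyps[of z2] st2 E2 that by metis
      qed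
      show ?thesis
        using aM xy z1 z2
        by (intro exI[of _ "add_mset x (add_mset y a)"] exI[of _ "add_mset (x, y) (add_mset (x, y) M)"])
          (auto simp: add_mset_commute)
    qed
  qed
qed

section \<open>Covers, the near-integral min-max theorem and weak duality\<close>

text \<open>A vertex cover of the bipartite double cover. As \<open>E\<close> is symmetric, half the
  sum of the indicators of \<open>X\<close> and \<open>Y\<close> is a half-integral fractional
  vertex cover of the graph.\<close>

definition covers :: "'v set \<Rightarrow> 'v set \<Rightarrow> bool" where
  "covers X Y \<longleftrightarrow> (\<forall>(u, v)\<in>E. u \<in> X \<or> v \<in> Y)"

definition half_closed :: bool where
  "half_closed \<longleftrightarrow> (\<forall>a M. set_mset M \<subseteq> E \<and> a + a = deg M \<and> even (size a) \<longrightarrow>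
     (\<exists>N. set_mset N \<subseteq> E \<and> a = deg N))"

text \<open>The circulation is at least as large as Koenig's matching, and \<open>2 * size N\<close>
  falls short of it by at most the one vertex cut from an odd cycle; this is the
  \<open>+ 1\<close>.\<close>

lemma matching_cover:
  assumes half_closed
  obtains N X Y where "set_mset N \<subseteq> E" "deg N \<subseteq># w" "covers X Y"
    "size {#u \<in># w. u \<in> X#} + size {#u \<in># w. u \<in> Y#} \<le> 2 * size N + 1"
proof -
  obtain z X Y where z: "set_mset z \<subseteq> E" "image_mset fst z \<subseteq># w" "image_mset snd z \<subseteq># w"
    "\<And>u v. (u, v) \<in> E \<Longrightarrow> u \<in> X \<or> v \<in> Y"
    "size z = size {#u \<in># w. u \<in> X#} + size {#v \<in># w. v \<in> Y#}"
    using koenig_multiset[of E w w] by blast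
  obtain c where c: "set_mset c \<subseteq> E" "image_mset fst c = image_mset snd c" "image_mset fst c \<subseteq># w" "size z \<le> size c"
    using symmetrize_matching[OF z(1-3)] by blast
  obtain a M where aM: "a \<subseteq># image_mset fst c" "set_mset M \<subseteq> E" "a + a = deg M" "even (size a)" "size c \<le> Suc (size a)"
  proof (cases "even (size c)")
    case True
    then show thesis using that[of "image_mset fst c" c] c by (simp add: deg_def)
  next
    case False
    then show thesis using odd_circulation[of c] c that by (metis even_Suc order_refl)
  qed
  then obtain N where N: "set_mset N \<subseteq> E" "a = deg N"
    using assms unfolding half_closed_def by blast
  moreover have "a \<subseteq># w" using aM(1) c(3) by (rule subset_mset.order_trans)
  moreover have "covers X Y" using z(4) unfolding covers_def by auto
  moreover have "size z \<le> 2 * size N + 1" using aM(5) c(4) N by simp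
  ultimately show thesis using that z(5) by metis
qed

text \<open>Gallai's passage from packing to covering: every vertex that the packing leaves over
  gets an edge of its own. If \<open>n\<close> edges are packed, this takes
  \<open>size w - n\<close> edges in all, and the bound by the cover carries over.\<close>

lemma cover_matching:
  assumes half_closed and noniso: "\<And>u. \<exists>v. (u, v) \<in> E"
  obtains N X Y where "set_mset N \<subseteq> E" "w \<subseteq># deg N" "covers X Y"
    "2 * size N + size {#u \<in># w. u \<in> X#} + size {#u \<in># w. u \<in> Y#} \<le> 2 * size w + 1"
proof -
  obtain N X Y where N: "set_mset N \<subseteq> E" "deg N \<subseteq># w" "covers X Y"
    "size {#u \<in># w. u \<in> X#} + size {#u \<in># w. u \<in> Y#} \<le> 2 * size N + 1"
    using matching_cover[OF assms(1)] by metis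
  obtain h where h: "\<And>u. (u, h u) \<in> E" using noniso by metis
  let ?N = "N + image_mset (\<lambda>u. (u, h u)) (w - deg N)"
  have "w \<subseteq># deg ?N" using N(2)
    by (simp add: deg_def image_mset.compositionality comp_def)
      (metis (no_types) mset_subset_eq_add_left subset_mset.add_diff_inverse union_assoc union_commute)
  moreover have "2 * size N \<le> size w" using size_mset_mono[OF N(2)] by simp
  then have "2 * size ?N + size {#u \<in># w. u \<in> X#} + size {#u \<in># w. u \<in> Y#} \<le> 2 * size w + 1"
    using N(4) by (simp add: size_Diff_submset[OF N(2)])
  ultimately show thesis using that[of ?N] N h by auto
qed

text \<open>Weak duality for packings: both arcs of an edge are covered, so each edge contributes at
  least 2 to the right-hand side.\<close>

lemma size_le_cover:
  assumes "set_mset N \<subseteq> E" "covers X Y" "deg N \<subseteq># w"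
  shows "2 * size N \<le> size {#u \<in># w. u \<in> X#} + size {#u \<in># w. u \<in> Y#}"
proof -
  have "2 * size N \<le> size {#u \<in># deg N. u \<in> X#} + size {#u \<in># deg N. u \<in> Y#}"
    using assms(1)
  proof (induction N)
    case (add e N)
    obtain u v where e: "e = (u, v)" by (cases e)
    then have "u \<in> X \<or> v \<in> Y" "v \<in> X \<or> u \<in> Y"
      using add.prems assms(2) sym[of u v] unfolding covers_def by auto
    then show ?case using add e by auto
  qed auto
  also have "\<dots> \<le> size {#u \<in># w. u \<in> X#} + size {#u \<in># w. u \<in> Y#}"
    by (intro add_mono size_mset_mono multiset_filter_mono assms)
  finally show ?thesis .
qed

text \<open>Weak duality for coverings: the bound for packings, applied to \<open>deg N\<close>
  itself, is passed to the complements of \<open>X\<close> and \<open>Y\<close>, where enlarging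
  \<open>w\<close> to \<open>deg N\<close> goes in the right direction.\<close>

lemma size_ge_cover:
  assumes "set_mset N \<subseteq> E" "covers X Y" "w \<subseteq># deg N"
  shows "2 * size w \<le> 2 * size N + size {#u \<in># w. u \<in> X#} + size {#u \<in># w. u \<in> Y#}"
proof -
  have part: "size {#u \<in># a. u \<in> Z#} + size {#u \<in># a. u \<notin> Z#} = size a" for a :: "'v multiset" and Z
    by (metis multiset_partition size_union)
  have "size {#u \<in># w. u \<notin> X#} + size {#u \<in># w. u \<notin> Y#} \<le> size {#u \<in># deg N. u \<notin> X#} + size {#u \<in># deg N. u \<notin> Y#}"
    by (intro add_mono size_mset_mono multiset_filter_mono assms)
  moreover have "2 * size N \<le> size {#u \<in># deg N. u \<in> X#} + size {#u \<in># deg N. u \<in> Y#}"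
    using size_le_cover[OF assms(1,2), of "deg N"] by simp
  ultimately show ?thesis
    using part[of X w] part[of Y w] part[of X "deg N"] part[of Y "deg N"] by simp
qed

section \<open>The lattice generated by the edges\<close>

text \<open>Congruence in the free abelian group on the vertices modulo the subgroup generated by
  the edges, with subtraction replaced by edge sums on both sides.\<close>

definition lattice_cong :: "'v multiset \<Rightarrow> 'v multiset \<Rightarrow> bool" where
  "lattice_cong a b \<longleftrightarrow> (\<exists>M N. set_mset M \<subseteq> E \<and> set_mset N \<subseteq> E \<and> a + deg M = b + deg N)"

lemma lattice_cong_refl [simp]: "lattice_cong a a"
  unfolding lattice_cong_def by (intro exI[of _ "{#}"]) simp

lemma lattice_cong_sym: "lattice_cong a b \<Longrightarrow> lattice_cong b a"
  unfolding lattice_cong_def by (blast dest: HOL.sym)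

lemma lattice_cong_add:
  assumes "lattice_cong a b" "lattice_cong c d"
  shows "lattice_cong (a + c) (b + d)"
proof -
  obtain M N M' N' where *: "set_mset M \<subseteq> E" "set_mset N \<subseteq> E" "a + deg M = b + deg N"
    "set_mset M' \<subseteq> E" "set_mset N' \<subseteq> E" "c + deg M' = d + deg N'"
    using assms unfolding lattice_cong_def by blast
  have "a + c + deg (M + M') = (a + deg M) + (c + deg M')" by (simp add: ac_simps)
  also have "\<dots> = b + d + deg (N + N')" unfolding * by (simp add: ac_simps)
  finally show ?thesis using * unfolding lattice_cong_def
    by (intro exI[of _ "M + M'"] exI[of _ "N + N'"]) auto
qed

lemma lattice_cong_cancel:
  assumes "lattice_cong (a + c) (b + c)" shows "lattice_cong a b"
proof -
  obtain M N where "set_mset M \<subseteq> E" "set_mset N \<subseteq> E" "(a + deg M) + c = (b + deg N) + c"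
    using assms unfolding lattice_cong_def by (auto simp: ac_simps)
  then show ?thesis unfolding lattice_cong_def by (intro exI[of _ M] exI[of _ N]) simp
qed

lemma lattice_cong_trans [trans]:
  assumes "lattice_cong a b" "lattice_cong b c" shows "lattice_cong a c"
  using lattice_cong_cancel[of a b c] lattice_cong_add[OF assms] by (simp add: union_commute)

lemma lattice_cong_edge: "(u, v) \<in> E \<Longrightarrow> lattice_cong {#u, v#} {#}"
  unfolding lattice_cong_def by (intro exI[of _ "{#}"] exI[of _ "{#(u, v)#}"]) simp

text \<open>
  Modulo the lattice of edges every vertex is \<open>o'\<close> or \<open>-o'\<close>. If \<open>2 o'\<close> is not in the lattice, this
  sign is a bipartition.
\<close>

lemma half_in_lattice:
  assumes conn: "\<And>u v. (u, v) \<in> E\<^sup>*"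
    and M: "set_mset M \<subseteq> E" "a + a = deg M" "even (size a)"
  shows "lattice_cong a {#}"
proof -
  fix o' :: 'v
  have dich: "lattice_cong {#u#} {#o'#} \<or> lattice_cong {#u, o'#} {#}" for u
    using conn[of o' u]
  proof (induction rule: rtrancl_induct)
    case (step u u')
    from step.IH show ?case
    proof
      assume "lattice_cong {#u#} {#o'#}"
      from lattice_cong_add[OF lattice_cong_sym[OF this] lattice_cong_refl[of "{#u'#}"]]
      show ?thesis using lattice_cong_edge[OF step.hyps(2)]
        by (auto intro: lattice_cong_trans simp: add_mset_commute)
    next
      assume "lattice_cong {#u, o'#} {#}"
      from lattice_cong_add[OF lattice_cong_refl[of "{#u'#}"] lattice_cong_sym[OF this]]
      have "lattice_cong {#u'#} ({#u, u'#} + {#o'#})" by (simp add: add_mset_commute)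
      moreover have "lattice_cong ({#u, u'#} + {#o'#}) ({#} + {#o'#})"
        by (intro lattice_cong_add lattice_cong_edge step lattice_cong_refl)
      ultimately have "lattice_cong {#u'#} {#o'#}" by (metis lattice_cong_trans empty_neutral(1))
      then show ?thesis ..
    qed
  qed simp
  have P: "lattice_cong b (replicate_mset (size b) o')" if "\<forall>u\<in>#b. lattice_cong {#u#} {#o'#}" for b
    using that
  proof (induction b)
    case (add u b)
    then show ?case using lattice_cong_add[of "{#u#}" "{#o'#}" b] by simp
  qed simp
  have Q: "lattice_cong (b + replicate_mset (size b) o') {#}" if "\<forall>u\<in>#b. lattice_cong {#u, o'#} {#}" for b
    using that
  proof (induction b)
    case (add u b)
    then show ?case using lattice_cong_add[of "{#u, o'#}" "{#}" "b + replicate_mset (size b) o'" "{#}"]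
      by (simp add: add_mset_commute)
  qed simp
  show ?thesis
  proof (cases "lattice_cong {#o', o'#} {#}")
    case True
    \<comment> \<open>Every vertex is now congruent to \<open>o'\<close>, so \<open>a\<close> is
      congruent to an even multiple of \<open>o'\<close>.\<close>
    have "lattice_cong {#u#} {#o'#}" for u
      using dich[of u]
    proof
      assume "lattice_cong {#u, o'#} {#}"
      with True have "lattice_cong {#u, o'#} {#o', o'#}"
        by (meson lattice_cong_trans lattice_cong_sym)
      then show ?thesis using lattice_cong_cancel[of "{#u#}" "{#o'#}" "{#o'#}"] by (simp add: add_mset_commute)
    qed
    then have "lattice_cong a (replicate_mset (size a) o')" using P by blast
    moreover have "lattice_cong (replicate_mset (2 * n) o') {#}" for n
    proof (induction n)
      case (Suc n)
      then show ?case using lattice_cong_add[OF True Suc] by simp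
    qed simp
    ultimately show ?thesis using M(3) by (metis dvdE lattice_cong_trans)
  next
    case False
    define p where "p u \<longleftrightarrow> lattice_cong {#u#} {#o'#}" for u
    \<comment> \<open>Adjacent vertices with equal signs would put twice \<open>o'\<close> into the
      lattice, because their sum is congruent to 0.\<close>
    have bip: "p u \<longleftrightarrow> \<not> p v" if "(u, v) \<in> E" for u v
    proof -
      have uv: "lattice_cong {#u, v#} {#}" using that by (rule lattice_cong_edge)
      have "\<not> (p u \<and> p v)"
      proof
        assume "p u \<and> p v"
        then have "lattice_cong {#u, v#} {#o', o'#}"
          using lattice_cong_add[of "{#u#}" "{#o'#}" "{#v#}" "{#o'#}"] unfolding p_def
          by (simp add: add_mset_commute)
        with uv False show False by (meson lattice_cong_trans lattice_cong_sym)
      qed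
      moreover have "p u \<or> p v"
      proof (rule ccontr)
        assume "\<not> (p u \<or> p v)"
        then have "lattice_cong {#u, o'#} {#}" "lattice_cong {#v, o'#} {#}"
          using dich unfolding p_def by blast+
        from lattice_cong_add[OF this] have "lattice_cong ({#o', o'#} + {#u, v#}) {#}"
          by (simp add: add_mset_commute)
        moreover from lattice_cong_add[OF lattice_cong_refl[of "{#o', o'#}"] uv]
        have "lattice_cong ({#o', o'#} + {#u, v#}) {#o', o'#}" by simp
        ultimately show False using False by (meson lattice_cong_trans lattice_cong_sym)
      qed
      ultimately show ?thesis by blast
    qed
    \<comment> \<open>Every arc joins the two classes, so \<open>deg M\<close>, and with it its half
      \<open>a\<close>, is balanced; the signs then cancel.\<close>
    have "size {#u \<in># deg M. p u#} = size {#u \<in># deg M. \<not> p u#}"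
      using M(1)
    proof (induction M)
      case (add e M)
      moreover have "p (fst e) \<longleftrightarrow> \<not> p (snd e)" using add.prems bip[of "fst e" "snd e"] by simp
      ultimately show ?case by auto
    qed simp
    then have eq: "size {#u \<in># a. p u#} = size {#u \<in># a. \<not> p u#}"
      unfolding M(2)[symmetric] by simp
    let ?r = "replicate_mset (size {#u \<in># a. p u#}) o'"
    have "lattice_cong {#u \<in># a. p u#} ?r" by (rule P) (simp add: p_def)
    from lattice_cong_add[OF this lattice_cong_refl[of "{#u \<in># a. \<not> p u#}"]]
    have "lattice_cong a ({#u \<in># a. \<not> p u#} + ?r)"
      by (simp add: union_commute flip: multiset_partition)
    also have "lattice_cong \<dots> {#}" unfolding eq
      by (rule Q) (use dich p_def in auto)
    finally show ?thesis .
  qed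
qed

end

subsection \<open>Leading exponents\<close>

text \<open>The order is decided at the least variable where two exponents differ. For finitely many
  variables this is the lexicographic order on lists of one fixed length, which is
  well-founded.\<close>

lemma wf_less_poly_mapping:
  "wf {(a, b :: 'v::{finite,linorder} \<Rightarrow>\<^sub>0 nat). a < b}"
proof -
  define xs :: "'v list" where "xs = sorted_list_of_set UNIV"
  have xs: "set xs = UNIV" "sorted_wrt (<) xs" by (simp_all add: xs_def sorted_list_of_set.strict_sorted_key_list_of_set)
  have "{(a, b :: 'v \<Rightarrow>\<^sub>0 nat). a < b} \<subseteq> inv_image (lex less_than) (\<lambda>a. map (Poly_Mapping.lookup a) xs)"
  proof clarify
    fix a b :: "'v \<Rightarrow>\<^sub>0 nat" assume "a < b"
    then obtain k where k: "Poly_Mapping.lookup a k < Poly_Mapping.lookup b k" "\<And>k'. k' < k \<Longrightarrow> Poly_Mapping.lookup a k' = Poly_Mapping.lookup b k'"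
      unfolding less_poly_mapping.rep_eq less_fun_def by blast
    have "k \<in> set xs" using xs(1) by simp
    then obtain us vs where "xs = us @ k # vs" by (meson split_list)
    moreover from this have "map (Poly_Mapping.lookup a) us = map (Poly_Mapping.lookup b) us"
      using xs(2) k(2) by (auto simp: sorted_wrt_append)
    ultimately have "map (Poly_Mapping.lookup a) xs = map (Poly_Mapping.lookup b) us @ Poly_Mapping.lookup a k # map (Poly_Mapping.lookup a) vs"
      "map (Poly_Mapping.lookup b) xs = map (Poly_Mapping.lookup b) us @ Poly_Mapping.lookup b k # map (Poly_Mapping.lookup b) vs"
      by simp_all
    then have "(map (Poly_Mapping.lookup a) xs, map (Poly_Mapping.lookup b) xs) \<in> lex less_than"
      unfolding lex_conv using k(1) by (intro CollectI case_prodI conjI exI) (assumption | simp)+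
    then show "(a, b) \<in> inv_image (lex less_than) (\<lambda>a. map (Poly_Mapping.lookup a) xs)" by simp
  qed
  then show ?thesis by (rule wf_subset[rotated]) (intro wf_inv_image wf_lex wf_less_than)
qed

definition lexp :: "('v::linorder, 'k::field) mpoly \<Rightarrow> ('v \<Rightarrow>\<^sub>0 nat)" where
  "lexp p = Max (Poly_Mapping.keys p)"

lemma lexp_in_keys: "p \<noteq> 0 \<Longrightarrow> lexp p \<in> Poly_Mapping.keys p"
  unfolding lexp_def by (intro Max_in) (auto simp: poly_mapping_eq_iff in_keys_iff fun_eq_iff)

lemma le_lexp: "a \<in> Poly_Mapping.keys p \<Longrightarrow> a \<le> lexp p"
  unfolding lexp_def by (intro Max_ge) auto

lemma lexp_eqI: "a \<in> Poly_Mapping.keys p \<Longrightarrow> (\<And>b. b \<in> Poly_Mapping.keys p \<Longrightarrow> b \<le> a) \<Longrightarrow> lexp p = a"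
  unfolding lexp_def by (intro Max_eqI) auto

text \<open>Once the leading terms are split off, all other products have strictly smaller
  exponents, as addition is strictly monotone.\<close>

lemma lookup_mult_lexp:
  fixes p q :: "('v::linorder, 'k::field) mpoly"
  shows "Poly_Mapping.lookup (p * q) (lexp p + lexp q) = Poly_Mapping.lookup p (lexp p) * Poly_Mapping.lookup q (lexp q)"
proof -
  define p' where "p' = p - Poly_Mapping.single (lexp p) (Poly_Mapping.lookup p (lexp p))"
  define q' where "q' = q - Poly_Mapping.single (lexp q) (Poly_Mapping.lookup q (lexp q))"
  have p': "a < lexp p" if "a \<in> Poly_Mapping.keys p'" for a
  proof -
    have "Poly_Mapping.lookup p' a \<noteq> 0" using that by (simp add: in_keys_iff)
    then have "a \<noteq> lexp p" "Poly_Mapping.lookup p a \<noteq> 0"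
      by (auto simp: p'_def lookup_minus lookup_single when_def split: if_splits)
    then show ?thesis using le_lexp[of a p] by (simp add: in_keys_iff)
  qed
  have q': "a < lexp q" if "a \<in> Poly_Mapping.keys q'" for a
  proof -
    have "Poly_Mapping.lookup q' a \<noteq> 0" using that by (simp add: in_keys_iff)
    then have "a \<noteq> lexp q" "Poly_Mapping.lookup q a \<noteq> 0"
      by (auto simp: q'_def lookup_minus lookup_single when_def split: if_splits)
    then show ?thesis using le_lexp[of a q] by (simp add: in_keys_iff)
  qed
  have "lexp p + lexp q \<notin> Poly_Mapping.keys (p' * q)"
  proof
    assume "lexp p + lexp q \<in> Poly_Mapping.keys (p' * q)"
    then obtain a b where "lexp p + lexp q = a + b" "a \<in> Poly_Mapping.keys p'" "b \<in> Poly_Mapping.keys q"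
      using keys_mult[of p' q] by blast
    then show False using p'[of a] le_lexp[of b q] add_less_le_mono[of a "lexp p" b "lexp q"] by simp
  qed
  moreover have "lexp p + lexp q \<notin> Poly_Mapping.keys (Poly_Mapping.single (lexp p) (Poly_Mapping.lookup p (lexp p)) * q')"
  proof
    assume "lexp p + lexp q \<in> Poly_Mapping.keys (Poly_Mapping.single (lexp p) (Poly_Mapping.lookup p (lexp p)) * q')"
    then obtain b where "lexp p + lexp q = lexp p + b" "b \<in> Poly_Mapping.keys q'"
      using keys_mult[of "Poly_Mapping.single (lexp p) (Poly_Mapping.lookup p (lexp p))" q'] by (auto split: if_splits)
    then show False using q'[of b] by simp
  qed
  moreover have "p * q = p' * q + (Poly_Mapping.single (lexp p) (Poly_Mapping.lookup p (lexp p)) * q' +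
      Poly_Mapping.single (lexp p + lexp q) (Poly_Mapping.lookup p (lexp p) * Poly_Mapping.lookup q (lexp q)))"
    unfolding p'_def q'_def mult_single[symmetric] by (simp add: algebra_simps)
  ultimately show ?thesis by (simp add: lookup_add in_keys_iff)
qed

lemma lexp_mult:
  fixes p q :: "('v::linorder, 'k::field) mpoly"
  assumes "p \<noteq> 0" "q \<noteq> 0"
  shows "lexp (p * q) = lexp p + lexp q"
proof (rule lexp_eqI)
  show "lexp p + lexp q \<in> Poly_Mapping.keys (p * q)"
    using lexp_in_keys[OF assms(1)] lexp_in_keys[OF assms(2)]
    by (simp add: in_keys_iff lookup_mult_lexp)
  fix b assume "b \<in> Poly_Mapping.keys (p * q)"
  then obtain c d where "b = c + d" "c \<in> Poly_Mapping.keys p" "d \<in> Poly_Mapping.keys q"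
    using keys_mult[of p q] by blast
  then show "b \<le> lexp p + lexp q" by (simp add: add_mono le_lexp)
qed

definition Lexp :: "('v::linorder, 'k::field) mpoly poly \<Rightarrow> ('v \<Rightarrow>\<^sub>0 nat) \<times> nat" where
  "Lexp p = (lexp (lead_coeff p), degree p)"

lemma Lexp_mult:
  fixes p q :: "('v::linorder, 'k::field) mpoly poly"
  shows "p \<noteq> 0 \<Longrightarrow> q \<noteq> 0 \<Longrightarrow> Lexp (p * q) = Lexp p + Lexp q"
  unfolding Lexp_def lead_coeff_mult by (simp add: degree_mult_eq lexp_mult)

definition term_less :: "(('v::linorder, 'k::field) mpoly poly) rel" where
  "term_less = inv_image (less_than <*lex*> {(a, b). a < b}) (\<lambda>p. (degree p, lexp (lead_coeff p)))"

lemma wf_term_less: "wf (term_less :: ('v::{finite,linorder}, 'k::field) mpoly poly rel)"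
  unfolding term_less_def by (intro wf_inv_image wf_lex_prod wf_less_than wf_less_poly_mapping)

abbreviation mterm :: "'k \<Rightarrow> ('v \<Rightarrow>\<^sub>0 nat) \<times> nat \<Rightarrow> ('v, 'k::field) mpoly poly" where
  "mterm c s \<equiv> monom (Poly_Mapping.single (fst s) c) (snd s)"

lemma mterm_mult:
  "mterm c s * mterm d t = (mterm (c * d) (s + t) :: ('v, 'k::field) mpoly poly)"
  by (simp add: mult_monom mult_single)

text \<open>One step of division: \<open>c\<close> is the quotient of the two leading coefficients
  in \<open>K\<close>. The result 0 is a separate case because \<open>lexp 0\<close> is the maximum
  of an empty set.\<close>

lemma cancel_leading_term:
  fixes p q :: "('v::linorder, 'k::field) mpoly poly"
  assumes "p \<noteq> 0" "q \<noteq> 0" "Lexp p = s + Lexp q"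
  obtains c where "c \<noteq> 0" "p - mterm c s * q = 0 \<or> (p - mterm c s * q, p) \<in> term_less"
proof -
  let ?P = "lead_coeff p" and ?Q = "lead_coeff q"
  define c where "c = Poly_Mapping.lookup ?P (lexp ?P) / Poly_Mapping.lookup ?Q (lexp ?Q)"
  have nz: "Poly_Mapping.lookup ?P (lexp ?P) \<noteq> 0" "Poly_Mapping.lookup ?Q (lexp ?Q) \<noteq> 0"
    using lexp_in_keys[of ?P] lexp_in_keys[of ?Q] assms by (auto simp: in_keys_iff)
  then have c: "c \<noteq> 0" by (simp add: c_def)
  let ?m = "mterm c s" and ?sc = "Poly_Mapping.single (fst s) c"
  have sc: "?sc \<noteq> 0" using c by (metis lookup_single_eq lookup_zero)
  then have "?m \<noteq> 0" by simp
  then have deg: "degree (?m * q) = degree p"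
    using assms by (simp add: degree_mult_eq degree_monom_eq sc Lexp_def prod_eq_iff)
  have lsc: "lexp ?sc = fst s" by (rule lexp_eqI) (auto simp: c)
  have le: "fst s + lexp ?Q = lexp ?P" using assms(3) by (auto simp: Lexp_def prod_eq_iff)
  have lc: "lead_coeff (?m * q) = ?sc * ?Q"
    unfolding lead_coeff_mult by (simp add: degree_monom_eq sc)
  have "p - ?m * q = 0 \<or> (p - ?m * q, p) \<in> term_less"
  proof (cases "p - ?m * q = 0 \<or> degree (p - ?m * q) < degree p")
    case True
    then show ?thesis by (auto simp: term_less_def)
  next
    case False
    then have deq: "degree (p - ?m * q) = degree p"
      using degree_diff_le[of p "degree p" "?m * q"] deg by simp
    have r: "lead_coeff (p - ?m * q) = ?P - ?sc * ?Q" (is "_ = ?r")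
      unfolding deq coeff_diff using lc deg by simp
    have "?r \<noteq> 0" using r False by (metis leading_coeff_0_iff)
    have "Poly_Mapping.lookup (?sc * ?Q) (lexp ?P) = c * Poly_Mapping.lookup ?Q (lexp ?Q)"
      using lookup_mult_lexp[of ?sc ?Q] by (simp add: lsc le)
    then have "Poly_Mapping.lookup ?r (lexp ?P) = 0" using nz by (simp add: lookup_minus c_def)
    moreover have "lexp ?r \<le> lexp ?P"
    proof -
      have "lexp ?r \<in> Poly_Mapping.keys ?P \<or> lexp ?r \<in> Poly_Mapping.keys (?sc * ?Q)"
        using lexp_in_keys[OF \<open>?r \<noteq> 0\<close>] by (auto simp: in_keys_iff lookup_minus)
      then show ?thesis
        using le_lexp[of "lexp ?r" ?P] le_lexp[of "lexp ?r" "?sc * ?Q"] lexp_mult[OF sc, of ?Q] assms(2)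
        by (auto simp: lsc le)
    qed
    moreover have "Poly_Mapping.lookup ?r (lexp ?r) \<noteq> 0"
      using lexp_in_keys[OF \<open>?r \<noteq> 0\<close>] by (simp add: in_keys_iff)
    ultimately have "lexp ?r < lexp ?P" by (metis order_le_imp_less_or_eq)
    then show ?thesis unfolding term_less_def using deq r by simp
  qed
  then show thesis using that c by blast
qed

subsection \<open>Monoid algebras\<close>

text \<open>The \<open>K\<close>-span of the monomials with exponents in \<open>S\<close>, the
  second component being the exponent of \<open>t\<close>. Describing it by supports gives direct
  access to leading terms.\<close>

definition monoid_algebra :: "(('v \<Rightarrow>\<^sub>0 nat) \<times> nat) set \<Rightarrow> ('v, 'k::field) mpoly poly set" where
  "monoid_algebra S = {p. \<forall>i. \<forall>a\<in>Poly_Mapping.keys (coeff p i). (a, i) \<in> S}"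

definition is_submonoid :: "'a::monoid_add set \<Rightarrow> bool" where
  "is_submonoid S \<longleftrightarrow> 0 \<in> S \<and> (\<forall>a\<in>S. \<forall>b\<in>S. a + b \<in> S)"

lemma subringD:
  assumes "is_subring A"
  shows "1 \<in> A" "0 \<in> A" "\<And>a b. a \<in> A \<Longrightarrow> b \<in> A \<Longrightarrow> a - b \<in> A" "\<And>a b. a \<in> A \<Longrightarrow> b \<in> A \<Longrightarrow> a * b \<in> A"
    "\<And>a. a \<in> A \<Longrightarrow> - a \<in> A" "\<And>a b. a \<in> A \<Longrightarrow> b \<in> A \<Longrightarrow> a + b \<in> A"
proof -
  show 1: "1 \<in> A" and d: "\<And>a b. a \<in> A \<Longrightarrow> b \<in> A \<Longrightarrow> a - b \<in> A"
    and "\<And>a b. a \<in> A \<Longrightarrow> b \<in> A \<Longrightarrow> a * b \<in> A"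
    using assms unfolding is_subring_def by auto
  show 0: "0 \<in> A" using d[OF 1 1] by simp
  show m: "- a \<in> A" if "a \<in> A" for a using d[OF 0 that] by simp
  show "a + b \<in> A" if "a \<in> A" "b \<in> A" for a b using d[OF that(1) m[OF that(2)]] by simp
qed

lemma subring_power: "is_subring A \<Longrightarrow> a \<in> A \<Longrightarrow> a ^ n \<in> A"
  by (induction n) (auto simp: subringD)

lemma subring_sum: "is_subring A \<Longrightarrow> (\<And>i. i \<in> I \<Longrightarrow> f i \<in> A) \<Longrightarrow> sum f I \<in> A"
  by (induction I rule: infinite_finite_induct) (auto simp: subringD)

lemma is_subring_monoid_algebra:
  assumes "is_submonoid S"
  shows "is_subring (monoid_algebra S :: ('v, 'k::field) mpoly poly set)"
proof -
  have zero: "(0, 0) \<in> S" using assms unfolding is_submonoid_def zero_prod_def by blast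
  have "(1 :: ('v, 'k) mpoly poly) \<in> monoid_algebra S"
    using zero by (auto simp: monoid_algebra_def coeff_1 split: if_splits)
  moreover have "p - q \<in> monoid_algebra S" if "p \<in> monoid_algebra S" "q \<in> monoid_algebra S"
    for p q :: "('v, 'k) mpoly poly"
    unfolding monoid_algebra_def
  proof clarify
    fix i a assume "a \<in> Poly_Mapping.keys (coeff (p - q) i)"
    then have "a \<in> Poly_Mapping.keys (coeff p i) \<union> Poly_Mapping.keys (coeff q i)"
      using keys_diff[of "coeff p i" "coeff q i"] by auto
    then show "(a, i) \<in> S" using that unfolding monoid_algebra_def by blast
  qed
  moreover have "p * q \<in> monoid_algebra S" if p: "p \<in> monoid_algebra S" and q: "q \<in> monoid_algebra S"
    for p q :: "('v, 'k) mpoly poly"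
    unfolding monoid_algebra_def
  proof clarify
    fix i a assume "a \<in> Poly_Mapping.keys (coeff (p * q) i)"
    then have "a \<in> Poly_Mapping.keys (\<Sum>j\<le>i. coeff p j * coeff q (i - j))" by (simp add: coeff_mult)
    then obtain j where j: "j \<le> i" "a \<in> Poly_Mapping.keys (coeff p j * coeff q (i - j))"
      using keys_sum[of "\<lambda>j. coeff p j * coeff q (i - j)" "{..i}"] by auto
    then obtain b c where bc: "a = b + c" "b \<in> Poly_Mapping.keys (coeff p j)" "c \<in> Poly_Mapping.keys (coeff q (i - j))"
      using keys_mult by blast
    then have "(b, j) + (c, i - j) \<in> S"
      using p q assms unfolding monoid_algebra_def is_submonoid_def by blast
    then show "(a, i) \<in> S" using bc j by simp
  qed
  ultimately show ?thesis unfolding is_subring_def by blast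
qed

lemma mterm_in_monoid_algebra:
  "c \<noteq> 0 \<Longrightarrow> mterm c s \<in> monoid_algebra S \<longleftrightarrow> s \<in> S"
  by (cases s) (auto simp: monoid_algebra_def)

lemma mterm_in_monoid_algebraI:
  "s \<in> S \<Longrightarrow> mterm c s \<in> monoid_algebra S"
  by (cases s) (auto simp: monoid_algebra_def split: if_splits)

lemma Lexp_in:
  assumes "p \<in> monoid_algebra S" "p \<noteq> 0" shows "Lexp p \<in> S"
  using assms lexp_in_keys[of "lead_coeff p"] unfolding monoid_algebra_def Lexp_def by auto

text \<open>
  Complete integral closedness: \<open>s\<close> is the difference \<open>x - y\<close>, and \<open>((+) s ^^ k) d\<close> is \<open>d + k s\<close>.
\<close>

definition completely_closed :: "(('v \<Rightarrow>\<^sub>0 nat) \<times> nat) set \<Rightarrow> bool" where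
  "completely_closed S \<longleftrightarrow> (\<forall>s d x y. d \<in> S \<longrightarrow> x \<in> S \<longrightarrow> y \<in> S \<longrightarrow> x = s + y \<longrightarrow>
     (\<forall>k. ((+) s ^^ k) d \<in> S) \<longrightarrow> s \<in> S)"

text \<open>An additive error \<open>d\<close> that does not grow with \<open>k\<close> is
  outweighed at \<open>k = Suc d\<close>. This removes the error from inequalities known for all
  multiples.\<close>

lemma nat_le_of_multiples: "x \<le> y" if "\<And>k::nat. k * x \<le> d + k * y" for d x y :: nat
proof (rule ccontr)
  assume "\<not> x \<le> y"
  then have "Suc d * Suc y \<le> Suc d * x" by (intro mult_le_mono2) simp
  with that[of "Suc d"] show False by simp
qed

text \<open>The leading exponent \<open>s\<close> of \<open>p / q\<close> lies in \<open>S\<close>,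
  because comparing leading exponents in the hypothesis puts \<open>Lexp d + k s\<close> into
  \<open>S\<close> for every \<open>k\<close>. Subtracting from \<open>p\<close> the term of
  exponent \<open>s\<close> times \<open>q\<close> keeps the hypothesis, with the same
  \<open>d\<close>, and lowers the leading term.\<close>

lemma almost_integral_quotient:
  fixes p q d :: "('v::{finite,linorder}, 'k::field) mpoly poly"
  assumes S: "is_submonoid S" "completely_closed S"
    and "d \<in> monoid_algebra S" "d \<noteq> 0" "q \<in> monoid_algebra S" "q \<noteq> 0"
    and "p \<in> monoid_algebra S" "\<And>k. \<exists>g\<in>monoid_algebra S. d * p ^ k = q ^ k * g"
  shows "\<exists>h\<in>monoid_algebra S. p = q * h"
  using assms(7,8)
proof (induction p rule: wf_induct_rule[OF wf_term_less])
  case (1 p)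
  note A = subringD[OF is_subring_monoid_algebra[OF S(1)]]
  show ?case
  proof (cases "p = 0")
    case True
    then show ?thesis using A by (intro bexI[of _ 0]) auto
  next
    case False
    have g: "\<exists>g\<in>S. Lexp d + Lexp (p ^ k) = Lexp (q ^ k) + g" for k
    proof -
      obtain g where g: "g \<in> monoid_algebra S" "d * p ^ k = q ^ k * g" using 1 by blast
      then have "g \<noteq> 0" using assms False by auto
      then show ?thesis
        using Lexp_in[OF g(1)] arg_cong[OF g(2), of Lexp] assms False by (auto simp: Lexp_mult)
    qed
    have snd_pow: "snd (Lexp (r ^ k)) = k * snd (Lexp r)" if "r \<noteq> 0" for r :: "('v, 'k) mpoly poly" and k
      using that by (simp add: Lexp_def degree_power_eq)
    have fst_pow: "Poly_Mapping.lookup (fst (Lexp (r ^ k))) v = k * Poly_Mapping.lookup (fst (Lexp r)) v"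
      if "r \<noteq> 0" for r :: "('v, 'k) mpoly poly" and k v
    proof (induction k)
      case 0
      have "lexp (1 :: ('v, 'k) mpoly) = 0" by (rule lexp_eqI) auto
      then show ?case by (simp add: Lexp_def)
    next
      case (Suc k)
      then show ?case using that by (simp add: Lexp_mult lookup_add)
    qed
    have le_snd: "snd (Lexp q) \<le> snd (Lexp p)"
    proof (rule nat_le_of_multiples)
      fix k
      obtain g where "Lexp d + Lexp (p ^ k) = Lexp (q ^ k) + g" using g by blast
      from arg_cong[OF this, of snd]
      show "k * snd (Lexp q) \<le> snd (Lexp d) + k * snd (Lexp p)"
        using False assms by (simp add: snd_pow)
    qed
    have le_fst: "Poly_Mapping.lookup (fst (Lexp q)) v \<le> Poly_Mapping.lookup (fst (Lexp p)) v" for v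
    proof (rule nat_le_of_multiples)
      fix k
      obtain g where "Lexp d + Lexp (p ^ k) = Lexp (q ^ k) + g" using g by blast
      from arg_cong[OF this, of "\<lambda>x. Poly_Mapping.lookup (fst x) v"]
      show "k * Poly_Mapping.lookup (fst (Lexp q)) v \<le> Poly_Mapping.lookup (fst (Lexp d)) v + k * Poly_Mapping.lookup (fst (Lexp p)) v"
        using False assms by (simp add: fst_pow lookup_add)
    qed
    \<comment> \<open>\<open>le_fst\<close> and \<open>le_snd\<close> ensure that the truncated
      subtraction is exact.\<close>
    define s where "s = (fst (Lexp p) - fst (Lexp q), snd (Lexp p) - snd (Lexp q))"
    have "fst (Lexp p) - fst (Lexp q) + fst (Lexp q) = fst (Lexp p)"
      by (rule poly_mapping_eqI) (simp add: lookup_add lookup_minus le_fst)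
    then have s: "Lexp p = s + Lexp q"
      using le_snd by (simp add: s_def prod_eq_iff)
    have shift: "Lexp d + Lexp (p ^ k) = Lexp (q ^ k) + ((+) s ^^ k) (Lexp d)" for k
    proof (induction k)
      case (Suc k)
      have "Lexp d + Lexp (p ^ Suc k) = (s + Lexp q) + (Lexp d + Lexp (p ^ k))"
        using Lexp_mult[of p "p ^ k"] False s by (simp add: ac_simps)
      also have "\<dots> = (Lexp q + Lexp (q ^ k)) + (s + ((+) s ^^ k) (Lexp d))"
        unfolding Suc by (simp only: ac_simps)
      also have "\<dots> = Lexp (q ^ Suc k) + ((+) s ^^ Suc k) (Lexp d)"
        using Lexp_mult[of q "q ^ k"] assms by simp
      finally show ?case .
    qed (simp add: add.commute)
    have "s \<in> S"
    proof -
      have "((+) s ^^ k) (Lexp d) \<in> S" for k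
        using g[of k] unfolding shift by auto
      then show ?thesis
        using S(2) s Lexp_in[of d S] Lexp_in[of p S] Lexp_in[of q S] assms 1(2) False
        unfolding completely_closed_def by blast
    qed
    obtain c where c: "c \<noteq> 0" "p - mterm c s * q = 0 \<or> (p - mterm c s * q, p) \<in> term_less"
      using cancel_leading_term[OF False assms(6) s] by blast
    let ?m = "mterm c s" and ?p = "p - mterm c s * q"
    have m: "?m \<in> monoid_algebra S" using \<open>s \<in> S\<close> by (rule mterm_in_monoid_algebraI)
    have p: "?p \<in> monoid_algebra S" using A m 1(2) assms(5) by blast
    have "\<exists>h\<in>monoid_algebra S. ?p = q * h"
    proof (cases "?p = 0")
      case True
      then show ?thesis using A by (intro bexI[of _ 0]) auto
    next
      case False
      have "\<exists>g\<in>monoid_algebra S. d * ?p ^ k = q ^ k * g" for k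
      proof -
        obtain h where h: "\<And>j. h j \<in> monoid_algebra S" "\<And>j. d * p ^ j = q ^ j * h j"
          using 1(3) by metis
        \<comment> \<open>In the binomial expansion \<open>d * p ^ j\<close> supplies
          \<open>q ^ j\<close>, and the subtracted multiple of \<open>q\<close> supplies the other
          \<open>k - j\<close> factors.\<close>
        have "d * ?p ^ k = d * (p + (- ?m) * q) ^ k" by (simp add: algebra_simps)
        also have "\<dots> = (\<Sum>j\<le>k. of_nat (k choose j) * (d * p ^ j) * (((- ?m) * q) ^ (k - j)))"
          unfolding binomial_ring[of p "(- ?m) * q" k] by (simp add: sum_distrib_left ac_simps)
        also have "\<dots> = (\<Sum>j\<le>k. q ^ k * (of_nat (k choose j) * h j * (- ?m) ^ (k - j)))"
        proof (rule sum.cong[OF refl])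
          fix j assume "j \<in> {..k}"
          then have "q ^ k = q ^ j * q ^ (k - j)" by (simp flip: power_add)
          then show "of_nat (k choose j) * (d * p ^ j) * (((- ?m) * q) ^ (k - j)) =
             q ^ k * (of_nat (k choose j) * h j * (- ?m) ^ (k - j))"
            unfolding h power_mult_distrib by (simp only: ac_simps)
        qed
        also have "\<dots> = q ^ k * (\<Sum>j\<le>k. of_nat (k choose j) * h j * (- ?m) ^ (k - j))"
          by (simp add: sum_distrib_left)
        finally have eq: "d * ?p ^ k = \<dots>" .
        have of_nat: "of_nat n \<in> monoid_algebra S" for n by (induction n) (auto simp: A)
        have "(\<Sum>j\<le>k. of_nat (k choose j) * h j * (- ?m) ^ (k - j)) \<in> monoid_algebra S"
          using is_subring_monoid_algebra[OF S(1)] h m of_nat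
          by (intro subring_sum A(4) subring_power A(5)) auto
        with eq show ?thesis by blast
      qed
      then show ?thesis using 1(1) c False p by blast
    qed
    then obtain h where "h \<in> monoid_algebra S" "?p = q * h" by blast
    then show ?thesis using m A
      by (intro bexI[of _ "h + ?m"]) (auto simp: algebra_simps)
  qed
qed

text \<open>For an integral equation of degree \<open>N\<close> the common denominator is
  \<open>d = q ^ N\<close>: it clears the powers below \<open>N\<close>, and the equation rewrites
  each higher power through lower ones.\<close>

lemma integral_imp_almost_integral:
  fixes A :: "'a::idom set"
  assumes A: "is_subring A" and "p \<in> A" "q \<in> A" "q \<noteq> 0"
    and "integral_over ((\<lambda>a. Fraction_Field.Fract a 1) ` A) (Fraction_Field.Fract p q)"
  obtains d where "d \<in> A" "d \<noteq> 0" "\<And>k. \<exists>g\<in>A. d * p ^ k = q ^ k * g"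
proof -
  define \<phi> :: "'a \<Rightarrow> 'a fract" where "\<phi> a = Fraction_Field.Fract a 1" for a
  have \<phi>: "\<phi> (a + b) = \<phi> a + \<phi> b" "\<phi> (a * b) = \<phi> a * \<phi> b" "\<phi> (- a) = - \<phi> a" "\<phi> 0 = 0" "\<phi> 1 = 1"
    "\<phi> a = \<phi> b \<longleftrightarrow> a = b" for a b
    by (simp_all add: \<phi>_def Zero_fract_def One_fract_def eq_fract)
  have \<phi>_pow: "\<phi> (a ^ n) = \<phi> a ^ n" for a n by (induction n) (auto simp: \<phi>)
  define z where "z = Fraction_Field.Fract p q"
  have z: "z * \<phi> q = \<phi> p" using assms(4) by (simp add: z_def \<phi>_def eq_fract)
  obtain P where P: "lead_coeff P = 1" "\<And>i. coeff P i \<in> \<phi> ` A" "poly P z = 0"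
    using assms(5) unfolding integral_over_def z_def \<phi>_def by blast
  define N where "N = degree P"
  have zN: "z ^ N = - (\<Sum>i<N. coeff P i * z ^ i)"
    using P(1,3) unfolding poly_altdef N_def by (simp add: atLeast0LessThan lessThan_Suc_atMost[symmetric] eq_neg_iff_add_eq_0 add.commute)
  have clA: "\<exists>g\<in>A. \<phi> (q ^ N) * z ^ k = \<phi> g" for k
  proof (induction k rule: less_induct)
    case (less k)
    show ?case
    proof (cases "k < N")
      case True
      then have "q ^ N = q ^ (N - k) * q ^ k" by (simp flip: power_add)
      then have "\<phi> (q ^ N) * z ^ k = \<phi> (q ^ (N - k)) * (z * \<phi> q) ^ k"
        by (simp add: \<phi> \<phi>_pow power_mult_distrib ac_simps)
      then have "\<phi> (q ^ N) * z ^ k = \<phi> (q ^ (N - k) * p ^ k)" by (simp add: z \<phi> \<phi>_pow)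
      then show ?thesis using assms subringD(4)[OF A] subring_power[OF A] by blast
    next
      case False
      then have "z ^ k = z ^ N * z ^ (k - N)" by (simp flip: power_add)
      then have eq: "\<phi> (q ^ N) * z ^ k = - (\<Sum>i<N. coeff P i * (\<phi> (q ^ N) * z ^ (i + (k - N))))"
        unfolding zN by (simp add: sum_distrib_left sum_distrib_right power_add ac_simps)
      have "\<exists>g\<in>A. coeff P i * (\<phi> (q ^ N) * z ^ (i + (k - N))) = \<phi> g" if "i < N" for i
      proof -
        have "i + (k - N) < k" using that False by simp
        then obtain g where "g \<in> A" "\<phi> (q ^ N) * z ^ (i + (k - N)) = \<phi> g" using less by blast
        moreover obtain c where "c \<in> A" "coeff P i = \<phi> c" using P(2)[of i] by blast
        ultimately show ?thesis using subringD(4)[OF A] by (intro bexI[of _ "c * g"]) (auto simp: \<phi>)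
      qed
      then obtain g where g: "\<And>i. i < N \<Longrightarrow> g i \<in> A" "\<And>i. i < N \<Longrightarrow> coeff P i * (\<phi> (q ^ N) * z ^ (i + (k - N))) = \<phi> (g i)"
        by metis
      have "\<phi> (\<Sum>i\<in>I. g i) = (\<Sum>i\<in>I. \<phi> (g i))" for I :: "nat set"
        by (induction I rule: infinite_finite_induct) (auto simp: \<phi>)
      then have "\<phi> (q ^ N) * z ^ k = \<phi> (- (\<Sum>i<N. g i))"
        unfolding eq by (simp add: \<phi> g)
      moreover have "- (\<Sum>i<N. g i) \<in> A"
        using g by (intro subringD(5)[OF A] subring_sum[OF A]) auto
      ultimately show ?thesis by blast
    qed
  qed
  have "\<exists>g\<in>A. q ^ N * p ^ k = q ^ k * g" for k
  proof -
    obtain g where g: "g \<in> A" "\<phi> (q ^ N) * z ^ k = \<phi> g" using clA by blast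
    have "\<phi> (q ^ N * p ^ k) = \<phi> (q ^ N) * (z * \<phi> q) ^ k" by (simp add: z \<phi> \<phi>_pow)
    also have "\<dots> = (\<phi> (q ^ N) * z ^ k) * \<phi> q ^ k" by (simp add: power_mult_distrib)
    also have "\<dots> = \<phi> (q ^ k * g)" unfolding g by (simp add: \<phi> \<phi>_pow)
    finally show ?thesis using g(1) by (auto simp: \<phi>(6))
  qed
  then show thesis using that[of "q ^ N"] assms subring_power[OF A] by simp
qed

text \<open>Integral quotients are almost integral, and complete closedness of \<open>S\<close>
  settles those.\<close>

theorem normal_monoid_algebra:
  assumes "is_submonoid S" "completely_closed S"
  shows "normal_subring (monoid_algebra S :: ('v::{finite,linorder}, 'k::field) mpoly poly set)"
  unfolding normal_subring_def Let_def
proof (intro conjI ballI impI)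
  let ?A = "monoid_algebra S :: ('v, 'k) mpoly poly set"
  show A: "is_subring ?A" using assms(1) by (rule is_subring_monoid_algebra)
  fix z assume "z \<in> fraction_field_of ?A" "integral_over ((\<lambda>a. Fraction_Field.Fract a 1) ` ?A) z"
  moreover from this obtain p q where pq: "z = Fraction_Field.Fract p q" "p \<in> ?A" "q \<in> ?A" "q \<noteq> 0"
    unfolding fraction_field_of_def by blast
  ultimately obtain d where "d \<in> ?A" "d \<noteq> 0" "\<And>k. \<exists>g\<in>?A. d * p ^ k = q ^ k * g"
    using integral_imp_almost_integral[OF A, of p q] by blast
  then obtain h where "h \<in> ?A" "p = q * h"
    using almost_integral_quotient[OF assms] pq by blast
  then show "z \<in> (\<lambda>a. Fraction_Field.Fract a 1) ` ?A"
    using pq by (auto simp: eq_fract intro!: image_eqI[of _ _ h])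
qed

text \<open>The monomial of exponent \<open>s\<close> is a quotient of two monomials of the algebra
  and a root of \<open>Z^2 - c\<close>, where \<open>c\<close> is its square.\<close>

lemma normal_monoid_algebra_half:
  assumes normal: "normal_subring (monoid_algebra S :: ('v::linorder, 'k::field) mpoly poly set)"
    and "x \<in> S" "y \<in> S" "x = s + y" "s + s \<in> S"
  shows "s \<in> S"
proof -
  let ?A = "monoid_algebra S :: ('v, 'k) mpoly poly set"
  let ?\<phi> = "\<lambda>a :: ('v, 'k) mpoly poly. Fraction_Field.Fract a 1"
  have A: "is_subring (?\<phi> ` ?A)"
    using normal unfolding normal_subring_def is_subring_def
    by (auto simp: One_fract_def[symmetric] intro!: image_eqI[where f = ?\<phi>])
  have coeffs: "coeff [:w, 0, 1:] i \<in> ?\<phi> ` ?A" if "w \<in> ?\<phi> ` ?A" for w i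
    using that subringD(1,2)[OF A] by (simp add: coeff_pCons split: nat.split)
  let ?z = "?\<phi> (mterm 1 s)"
  have "mterm 1 x = mterm 1 s * (mterm 1 y :: ('v, 'k) mpoly poly)"
    by (simp add: mult_monom mult_single assms(4))
  moreover have ynz: "mterm 1 y \<noteq> (0 :: ('v, 'k) mpoly poly)"
    by (metis lookup_single_eq lookup_zero monom_eq_0_iff zero_neq_one)
  ultimately have "Fraction_Field.Fract (mterm 1 x) (mterm 1 y) = ?z"
    by (simp add: eq_fract)
  moreover have "mterm 1 x \<in> ?A" "mterm 1 y \<in> ?A"
    using assms(2,3) by (auto intro: mterm_in_monoid_algebraI)
  ultimately have "?z \<in> fraction_field_of ?A"
    using ynz unfolding fraction_field_of_def by (metis (mono_tags, lifting) mem_Collect_eq)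
  moreover have "integral_over (?\<phi> ` ?A) ?z"
    unfolding integral_over_def
  proof (intro exI conjI allI)
    let ?P = "[:- ?\<phi> (mterm 1 (s + s)), 0, 1:]"
    show "lead_coeff ?P = 1" by simp
    have "?\<phi> (mterm 1 (s + s)) \<in> ?\<phi> ` ?A"
      using assms(5) by (intro imageI) (rule mterm_in_monoid_algebraI)
    from subringD(5)[OF A this] show "coeff ?P i \<in> ?\<phi> ` ?A" for i
      by (rule coeffs)
    show "poly ?P ?z = 0" by (simp add: mterm_mult flip: Zero_fract_def)
  qed
  ultimately have "?z \<in> ?\<phi> ` ?A"
    using normal unfolding normal_subring_def Let_def by blast
  then have "mterm 1 s \<in> ?A" by (auto simp: eq_fract)
  then show ?thesis by (simp add: mterm_in_monoid_algebra)
qed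

lemma mterm_sum: "p = (\<Sum>i\<le>degree p. \<Sum>a\<in>Poly_Mapping.keys (coeff p i). mterm (Poly_Mapping.lookup (coeff p i) a) (a, i))"
proof -
  have "coeff p i = (\<Sum>a\<in>Poly_Mapping.keys (coeff p i). Poly_Mapping.single a (Poly_Mapping.lookup (coeff p i) a))" for i
    by (rule poly_mapping_eqI)
      (auto simp: lookup_sum lookup_single when_def sum.delta in_keys_iff cong: if_cong)
  then have "monom (coeff p i) i = (\<Sum>a\<in>Poly_Mapping.keys (coeff p i). mterm (Poly_Mapping.lookup (coeff p i) a) (a, i))" for i
    by (metis (no_types, lifting) fst_conv monom_sum snd_conv sum.cong)
  then show ?thesis using poly_as_sum_of_monoms[of p] by simp
qed

inductive_set monoid_gen :: "'a::monoid_add set \<Rightarrow> 'a set" for G where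
  zero: "0 \<in> monoid_gen G"
| add: "g \<in> G \<Longrightarrow> s \<in> monoid_gen G \<Longrightarrow> g + s \<in> monoid_gen G"

lemma is_submonoid_monoid_gen: "is_submonoid (monoid_gen G)"
proof -
  have "a + b \<in> monoid_gen G" if "a \<in> monoid_gen G" "b \<in> monoid_gen G" for a b
    using that by (induction a) (auto simp: add.assoc intro: monoid_gen.add)
  then show ?thesis by (auto simp: is_submonoid_def intro: monoid_gen.zero)
qed

text \<open>Constants are among the ring generators, so every term with exponent in the monoid is
  reached, and every element is a sum of such terms.\<close>

lemma subalgebra_gen_mterms:
  "subalgebra_gen (mterm 1 ` G) = (monoid_algebra (monoid_gen G) :: ('v, 'k::field) mpoly poly set)"
proof
  show "subalgebra_gen (mterm 1 ` G) \<subseteq> (monoid_algebra (monoid_gen G) :: ('v, 'k::field) mpoly poly set)"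
    unfolding subalgebra_gen_def
  proof (rule hull_minimal)
    have "[:Const c:] \<in> (monoid_algebra (monoid_gen G) :: ('v, 'k) mpoly poly set)" for c :: 'k
      using mterm_in_monoid_algebraI[OF monoid_gen.zero, of c] by (simp add: Const_def monom_0)
    moreover have "g \<in> monoid_gen G" if "g \<in> G" for g
      using monoid_gen.add[OF that monoid_gen.zero] by simp
    ultimately show "range (\<lambda>c. [:Const c:]) \<union> mterm 1 ` G \<subseteq> (monoid_algebra (monoid_gen G) :: ('v, 'k::field) mpoly poly set)"
      by (auto intro!: mterm_in_monoid_algebraI)
  qed (rule is_subring_monoid_algebra[OF is_submonoid_monoid_gen])
  let ?H = "subalgebra_gen (mterm 1 ` G) :: ('v, 'k) mpoly poly set"
  have H: "is_subring ?H" unfolding subalgebra_gen_def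
    by (rule hull_in) (auto simp: is_subring_def)
  have gen: "range (\<lambda>c. [:Const c:]) \<union> mterm 1 ` G \<subseteq> ?H"
    unfolding subalgebra_gen_def by (rule hull_subset)
  have terms: "mterm c s \<in> ?H" if "s \<in> monoid_gen G" for c s
    using that
  proof induction
    case zero
    have "[:Const c:] \<in> ?H" using gen by blast
    then show ?case by (simp add: Const_def monom_0)
  next
    case (add g s)
    have "mterm 1 g * mterm c s \<in> ?H"
      using subringD(4)[OF H] gen add by blast
    then show ?case unfolding mterm_mult by simp
  qed
  show "monoid_algebra (monoid_gen G) \<subseteq> ?H"
  proof
    fix p :: "('v, 'k) mpoly poly" assume p: "p \<in> monoid_algebra (monoid_gen G)"
    have "(\<Sum>i\<le>degree p. \<Sum>a\<in>Poly_Mapping.keys (coeff p i). mterm (Poly_Mapping.lookup (coeff p i) a) (a, i)) \<in> ?H"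
      using p by (intro subring_sum[OF H] terms) (auto simp: monoid_algebra_def)
    then show "p \<in> ?H" unfolding mterm_sum[symmetric] .
  qed
qed

subsection \<open>Multisets as exponents\<close>

text \<open>Multisets and exponent vectors are the same data; the combinatorics uses the former and
  the algebra the latter.\<close>

definition expo :: "'v multiset \<Rightarrow> ('v \<Rightarrow>\<^sub>0 nat)" where
  "expo a = Abs_poly_mapping (count a)"

lemma lookup_expo [simp]: "Poly_Mapping.lookup (expo a) v = count a v"
  unfolding expo_def by (subst lookup_Abs_poly_mapping) (auto simp: finite_set_mset[unfolded set_mset_def])

lemma expo_add [simp]: "expo (a + b) = expo a + expo b"
  by (rule poly_mapping_eqI) (simp add: lookup_add)

lemma expo_empty [simp]: "expo {#} = 0"
  by (rule poly_mapping_eqI) simp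

lemma expo_add_mset: "expo (add_mset v a) = Poly_Mapping.single v 1 + expo a"
  by (rule poly_mapping_eqI) (auto simp: lookup_add lookup_single when_def)

lemma expo_eq_iff [simp]: "expo a = expo b \<longleftrightarrow> a = b"
proof
  assume "expo a = expo b"
  then have "Poly_Mapping.lookup (expo a) v = Poly_Mapping.lookup (expo b) v" for v by simp
  then show "a = b" by (intro multiset_eqI) simp
qed simp

lemma expo_surj: "\<exists>a. x = expo a"
proof
  have "finite {v. 0 < Poly_Mapping.lookup x v}" using finite_lookup[of x] by simp
  then have "count (Abs_multiset (Poly_Mapping.lookup x)) = Poly_Mapping.lookup x"
    by (rule count_Abs_multiset)
  then show "x = expo (Abs_multiset (Poly_Mapping.lookup x))"
    by (intro poly_mapping_eqI) simp
qed

abbreviation expos :: "('v multiset \<times> nat) set \<Rightarrow> (('v \<Rightarrow>\<^sub>0 nat) \<times> nat) set" where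
  "expos T \<equiv> (\<lambda>(a, b). (expo a, b)) ` T"

lemma expos_iff [simp]: "(expo a, b) \<in> expos T \<longleftrightarrow> (a, b) \<in> T"
  by auto

lemma is_submonoid_expos:
  assumes "({#}, 0) \<in> T" "\<And>a b c d. (a, b) \<in> T \<Longrightarrow> (c, d) \<in> T \<Longrightarrow> (a + c, b + d) \<in> T"
  shows "is_submonoid (expos T)"
  unfolding is_submonoid_def
proof (intro conjI ballI)
  show "0 \<in> expos T" using assms(1) by (auto simp: zero_prod_def intro!: image_eqI[of _ _ "({#}, 0)"])
  fix x y assume "x \<in> expos T" "y \<in> expos T"
  then obtain a b c d where "x = (expo a, b)" "y = (expo c, d)" "(a, b) \<in> T" "(c, d) \<in> T" by auto
  then show "x + y \<in> expos T"
    using assms(2) by (auto intro!: image_eqI[of _ _ "(a + c, b + d)"])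
qed

lemma completely_closed_expos:
  assumes "\<And>a b d e y z. (d, e) \<in> T \<Longrightarrow> (y, z) \<in> T \<Longrightarrow> (a + y, b + z) \<in> T \<Longrightarrow>
    (\<And>k. (repeat_mset k a + d, k * b + e) \<in> T) \<Longrightarrow> (a, b) \<in> T"
  shows "completely_closed (expos T)"
  unfolding completely_closed_def
proof (intro allI impI)
  fix s d x y assume *: "d \<in> expos T" "x \<in> expos T" "y \<in> expos T" "x = s + y" "\<forall>k. ((+) s ^^ k) d \<in> expos T"
  obtain a b where s: "s = (expo a, b)" by (metis expo_surj surj_pair)
  from * obtain d1 d2 y1 y2 where d: "d = (expo d1, d2)" "(d1, d2) \<in> T" and y: "y = (expo y1, y2)" "(y1, y2) \<in> T"
    by auto
  have "x = (expo (a + y1), b + y2)" using * s y by simp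
  then have "(a + y1, b + y2) \<in> T" using * by (metis expos_iff)
  moreover have "(repeat_mset k a + d1, k * b + d2) \<in> T" for k
  proof -
    have "((+) s ^^ k) d = (expo (repeat_mset k a + d1), k * b + d2)"
      by (induction k) (simp_all add: s d ac_simps)
    then show ?thesis using *(5) by (metis expos_iff)
  qed
  ultimately have "(a, b) \<in> T" using assms d y by blast
  then show "s \<in> expos T" by (simp add: s)
qed

lemma size_filter_repeat_mset:
  "size {#v \<in># repeat_mset k a. P v#} = k * size {#v \<in># a. P v#}"
  by (induction k) auto

lemma exists_submultiset_of_size:
  "n \<le> size N \<Longrightarrow> \<exists>M. M \<subseteq># N \<and> size M = n"
proof (induction N)
  case (add e N)
  show ?case
  proof (cases "n \<le> size N")
    case True
    then obtain M where "M \<subseteq># N" "size M = n" using add.IH by blast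
    moreover have "N \<subseteq># add_mset e N" by simp
    ultimately show ?thesis by (intro exI[of _ M]) (auto intro: subset_mset.order_trans)
  next
    case False
    then show ?thesis using add.prems by (intro exI[of _ "add_mset e N"]) simp
  qed
qed auto

lemma eq_of_subset_size: "a = b" if "a \<subseteq># b" "size b \<le> size a" for a b :: "'a multiset"
  using that mset_subset_size[of a b] by (auto simp: subset_mset.less_le)

subsection \<open>The exponent monoids\<close>

definition arcs :: "('q \<Rightarrow> 'n set) \<Rightarrow> ('n \<times> 'n) set" where
  "arcs f = {(u, v). \<exists>k. f k = {u, v}}"

locale graph =
  fixes f :: "'q::finite \<Rightarrow> 'n::{finite,linorder} set"
  assumes simple: "simple_graph f" and noniso: "no_isolated_vertices f"
begin

lemma edge_obtain:
  obtains u v where "f k = {u, v}" "u \<noteq> v" "(u, v) \<in> arcs f"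
proof -
  have "card (f k) = 2" using simple unfolding simple_graph_def by blast
  then obtain u v where "f k = {u, v}" "u \<noteq> v" by (auto simp: card_2_iff)
  then show thesis by (intro that[of u v]) (auto simp: arcs_def)
qed

sublocale adjacency "arcs f"
proof
  fix u v show "(u, v) \<in> arcs f \<Longrightarrow> (v, u) \<in> arcs f"
    by (simp add: arcs_def insert_commute[of u v])
  show "(u, u) \<notin> arcs f"
  proof
    assume "(u, u) \<in> arcs f"
    then obtain k where "f k = {u}" unfolding arcs_def by auto
    moreover have "card (f k) = 2" using simple unfolding simple_graph_def by blast
    ultimately show False by simp
  qed
qed

lemma arc_exists: "\<exists>v. (u, v) \<in> arcs f"
proof -
  obtain k where k: "u \<in> f k" using noniso unfolding no_isolated_vertices_def by blast
  obtain x y where xy: "f k = {x, y}" "(x, y) \<in> arcs f" by (rule edge_obtain[of k])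
  from sym[OF xy(2)] have "(y, x) \<in> arcs f" .
  with k xy show ?thesis by auto
qed

text \<open>The exponents of the subring generated by \<open>t\<close> times the edge
  monomials.\<close>

definition edge_sums :: "('n multiset \<times> nat) set" where
  "edge_sums = {(a, b). \<exists>M. set_mset M \<subseteq> arcs f \<and> size M = b \<and> a = deg M}"

text \<open>The exponents of the Rees algebra: a monomial lies in the \<open>b\<close>-th power of
  the edge ideal when a product of \<open>b\<close> edges divides it.\<close>

definition edge_sums_above :: "('n multiset \<times> nat) set" where
  "edge_sums_above = {(a, b). \<exists>M. set_mset M \<subseteq> arcs f \<and> size M = b \<and> deg M \<subseteq># a}"

text \<open>The exponents of the extended subring: its generators are \<open>t\<close> times 1, a
  variable or an edge monomial, so each of the \<open>b\<close> factors divides an edge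
  monomial.\<close>

definition edge_sums_below :: "('n multiset \<times> nat) set" where
  "edge_sums_below = {(a, b). \<exists>M. set_mset M \<subseteq> arcs f \<and> size M = b \<and> a \<subseteq># deg M}"

lemma edge_sums_mem: "set_mset M \<subseteq> arcs f \<Longrightarrow> size M = b \<Longrightarrow> a = deg M \<Longrightarrow> (a, b) \<in> edge_sums"
  unfolding edge_sums_def mem_Collect_eq case_prod_conv by (intro exI[of _ M] conjI)

lemma edge_sums_above_mem:
  "set_mset M \<subseteq> arcs f \<Longrightarrow> size M = b \<Longrightarrow> deg M \<subseteq># a \<Longrightarrow> (a, b) \<in> edge_sums_above"
  unfolding edge_sums_above_def mem_Collect_eq case_prod_conv by (intro exI[of _ M] conjI)

lemma edge_sums_below_mem:
  "set_mset M \<subseteq> arcs f \<Longrightarrow> size M = b \<Longrightarrow> a \<subseteq># deg M \<Longrightarrow> (a, b) \<in> edge_sums_below"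
  unfolding edge_sums_below_def mem_Collect_eq case_prod_conv by (intro exI[of _ M] conjI)

lemma edge_sumsE:
  assumes "(a, b) \<in> edge_sums"
  obtains M where "set_mset M \<subseteq> arcs f" "size M = b" "a = deg M"
  using assms unfolding edge_sums_def mem_Collect_eq case_prod_conv by (elim exE conjE) (rule that)

lemma edge_sums_aboveE:
  assumes "(a, b) \<in> edge_sums_above"
  obtains M where "set_mset M \<subseteq> arcs f" "size M = b" "deg M \<subseteq># a"
  using assms unfolding edge_sums_above_def mem_Collect_eq case_prod_conv by (elim exE conjE) (rule that)

lemma edge_sums_belowE:
  assumes "(a, b) \<in> edge_sums_below"
  obtains M where "set_mset M \<subseteq> arcs f" "size M = b" "a \<subseteq># deg M"
  using assms unfolding edge_sums_below_def mem_Collect_eq case_prod_conv by (elim exE conjE) (rule that)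

lemma is_submonoid_edge_sums: "is_submonoid (expos edge_sums)"
proof (rule is_submonoid_expos)
  show "({#}, 0) \<in> edge_sums" by (rule edge_sums_mem[of "{#}"]) simp_all
  fix a b c d assume *: "(a, b) \<in> edge_sums" "(c, d) \<in> edge_sums"
  obtain M where M: "set_mset M \<subseteq> arcs f" "size M = b" "a = deg M" using edge_sumsE[OF *(1)] .
  obtain N where N: "set_mset N \<subseteq> arcs f" "size N = d" "c = deg N" using edge_sumsE[OF *(2)] .
  show "(a + c, b + d) \<in> edge_sums"
    by (rule edge_sums_mem[of "M + N"]) (simp_all add: M N subset_mset.add_mono)
qed

lemma is_submonoid_edge_sums_above: "is_submonoid (expos edge_sums_above)"
proof (rule is_submonoid_expos)
  show "({#}, 0) \<in> edge_sums_above" by (rule edge_sums_above_mem[of "{#}"]) simp_all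
  fix a b c d assume *: "(a, b) \<in> edge_sums_above" "(c, d) \<in> edge_sums_above"
  obtain M where M: "set_mset M \<subseteq> arcs f" "size M = b" "deg M \<subseteq># a" using edge_sums_aboveE[OF *(1)] .
  obtain N where N: "set_mset N \<subseteq> arcs f" "size N = d" "deg N \<subseteq># c" using edge_sums_aboveE[OF *(2)] .
  show "(a + c, b + d) \<in> edge_sums_above"
    by (rule edge_sums_above_mem[of "M + N"]) (simp_all add: M N subset_mset.add_mono)
qed

lemma is_submonoid_edge_sums_below: "is_submonoid (expos edge_sums_below)"
proof (rule is_submonoid_expos)
  show "({#}, 0) \<in> edge_sums_below" by (rule edge_sums_below_mem[of "{#}"]) simp_all
  fix a b c d assume *: "(a, b) \<in> edge_sums_below" "(c, d) \<in> edge_sums_below"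
  obtain M where M: "set_mset M \<subseteq> arcs f" "size M = b" "a \<subseteq># deg M" using edge_sums_belowE[OF *(1)] .
  obtain N where N: "set_mset N \<subseteq> arcs f" "size N = d" "c \<subseteq># deg N" using edge_sums_belowE[OF *(2)] .
  show "(a + c, b + d) \<in> edge_sums_below"
    by (rule edge_sums_below_mem[of "M + N"]) (simp_all add: M N subset_mset.add_mono)
qed

section \<open>Complete integral closedness from covers\<close>

text \<open>The cover from \<open>matching_cover\<close> gives
  \<open>2 * b <= 2 * size N + 1\<close>; parity absorbs the 1, and surplus edges are
  discarded.\<close>

lemma edge_sums_aboveI:
  assumes half_closed
    and "\<And>X Y. covers X Y \<Longrightarrow> 2 * b \<le> size {#v \<in># a. v \<in> X#} + size {#v \<in># a. v \<in> Y#}"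
  shows "(a, b) \<in> edge_sums_above"
proof -
  obtain N X Y where N: "set_mset N \<subseteq> arcs f" "deg N \<subseteq># a" "covers X Y"
    "size {#u \<in># a. u \<in> X#} + size {#u \<in># a. u \<in> Y#} \<le> 2 * size N + 1"
    using matching_cover[OF assms(1)] by metis
  then have "b \<le> size N" using assms(2)[OF N(3)] by simp
  from exists_submultiset_of_size[OF this] obtain M where M: "M \<subseteq># N" "size M = b" by (elim exE conjE)
  have "deg M \<subseteq># deg N"
    unfolding deg_def by (intro subset_mset.add_mono image_mset_subseteq_mono M)
  then have "deg M \<subseteq># a" using N(2) by (rule subset_mset.order_trans)
  moreover have "set_mset M \<subseteq> arcs f" using set_mset_mono[OF M(1)] N(1) by (rule order_trans)
  ultimately show ?thesis using M(2) by (intro edge_sums_above_mem[of M]) simp_all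
qed

text \<open>Dually, parity gives \<open>size N <= b\<close>, and copies of an arbitrary edge make up
  the difference.\<close>

lemma edge_sums_belowI:
  assumes half_closed
    and "\<And>X Y. covers X Y \<Longrightarrow> 2 * size a \<le> 2 * b + size {#v \<in># a. v \<in> X#} + size {#v \<in># a. v \<in> Y#}"
  shows "(a, b) \<in> edge_sums_below"
proof -
  obtain N X Y where N: "set_mset N \<subseteq> arcs f" "a \<subseteq># deg N" "covers X Y"
    "2 * size N + size {#u \<in># a. u \<in> X#} + size {#u \<in># a. u \<in> Y#} \<le> 2 * size a + 1"
    using cover_matching[OF assms(1) arc_exists] by metis
  then have le: "size N \<le> b" using assms(2)[OF N(3)] by simp
  obtain e where e: "e \<in> arcs f" using arc_exists by blast
  let ?M = "N + replicate_mset (b - size N) e"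
  show ?thesis
  proof (rule edge_sums_below_mem)
    show "a \<subseteq># deg ?M" by (rule subset_mset.order_trans[OF N(2)]) simp
    show "set_mset ?M \<subseteq> arcs f" using N(1) e by simp
    show "size ?M = b" using le by simp
  qed
qed

text \<open>Membership follows from one homogeneous inequality per cover. Weak duality gives it for
  \<open>k\<close> times (\<open>a\<close>, \<open>b\<close>) plus (\<open>d\<close>,
  \<open>e\<close>), and letting \<open>k\<close> grow removes the contribution of
  (\<open>d\<close>, \<open>e\<close>).\<close>

lemma completely_closed_edge_sums_above:
  assumes half_closed
  shows "completely_closed (expos edge_sums_above)"
proof (rule completely_closed_expos)
  fix a b d e y z assume T: "\<And>k. (repeat_mset k a + d, k * b + e) \<in> edge_sums_above"
  show "(a, b) \<in> edge_sums_above"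
  proof (rule edge_sums_aboveI[OF assms], rule nat_le_of_multiples)
    fix X Y k assume "covers X Y"
    obtain M where "set_mset M \<subseteq> arcs f" "size M = k * b + e" "deg M \<subseteq># repeat_mset k a + d"
      using edge_sums_aboveE[OF T[of k]] .
    from size_le_cover[OF this(1) \<open>covers X Y\<close> this(3)] this(2)
    show "k * (2 * b) \<le> (size {#v \<in># d. v \<in> X#} + size {#v \<in># d. v \<in> Y#}) +
        k * (size {#v \<in># a. v \<in> X#} + size {#v \<in># a. v \<in> Y#})"
      unfolding filter_union_mset size_union size_repeat_mset size_filter_repeat_mset add_mult_distrib2 mult.left_commute[of k 2]
      by linarith
  qed
qed

text \<open>The same argument, with weak duality for coverings.\<close>

lemma completely_closed_edge_sums_below:
  assumes half_closed
  shows "completely_closed (expos edge_sums_below)"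
proof (rule completely_closed_expos)
  fix a b d e y z assume T: "\<And>k. (repeat_mset k a + d, k * b + e) \<in> edge_sums_below"
  show "(a, b) \<in> edge_sums_below"
  proof (rule edge_sums_belowI[OF assms], rule nat_le_of_multiples)
    fix X Y k assume "covers X Y"
    obtain M where "set_mset M \<subseteq> arcs f" "size M = k * b + e" "repeat_mset k a + d \<subseteq># deg M"
      using edge_sums_belowE[OF T[of k]] .
    from size_ge_cover[OF this(1) \<open>covers X Y\<close> this(3)] this(2)
    show "k * (2 * size a) \<le> (2 * e + size {#v \<in># d. v \<in> X#} + size {#v \<in># d. v \<in> Y#}) +
        k * (2 * b + size {#v \<in># a. v \<in> X#} + size {#v \<in># a. v \<in> Y#})"
      unfolding filter_union_mset size_union size_repeat_mset size_filter_repeat_mset add_mult_distrib2 mult.left_commute[of k 2]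
      by linarith
  qed
qed

text \<open>The covers yield \<open>b\<close> edges inside \<open>a\<close>. As a difference of edge
  sums, (\<open>a\<close>, \<open>b\<close>) satisfies \<open>size a = 2 * b\<close>, so these edges
  exhaust \<open>a\<close>.\<close>

lemma completely_closed_edge_sums:
  assumes half_closed
  shows "completely_closed (expos edge_sums)"
proof (rule completely_closed_expos)
  fix a b d e y z
  assume yz: "(y, z) \<in> edge_sums" "(a + y, b + z) \<in> edge_sums"
    and T: "\<And>k. (repeat_mset k a + d, k * b + e) \<in> edge_sums"
  have "(a, b) \<in> edge_sums_above"
  proof (rule edge_sums_aboveI[OF assms], rule nat_le_of_multiples)
    fix X Y k assume "covers X Y"
    obtain M where M: "set_mset M \<subseteq> arcs f" "size M = k * b + e" "deg M = repeat_mset k a + d"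
      using edge_sumsE[OF T[of k]] by metis
    from size_le_cover[OF this(1) \<open>covers X Y\<close> subset_mset.order_refl[of "deg M"]] this(2)
    show "k * (2 * b) \<le> (size {#v \<in># d. v \<in> X#} + size {#v \<in># d. v \<in> Y#}) +
        k * (size {#v \<in># a. v \<in> X#} + size {#v \<in># a. v \<in> Y#})"
      unfolding M(3) filter_union_mset size_union size_filter_repeat_mset add_mult_distrib2 mult.left_commute[of k 2]
      by linarith
  qed
  from edge_sums_aboveE[OF this]
  obtain M where M: "set_mset M \<subseteq> arcs f" "size M = b" "deg M \<subseteq># a" .
  obtain P where P: "size P = z" "y = deg P" using edge_sumsE[OF yz(1)] .
  obtain Q where Q: "size Q = b + z" "a + y = deg Q" using edge_sumsE[OF yz(2)] .
  have "size a = 2 * b" using arg_cong[OF Q(2), of size] by (simp add: P Q(1))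
  then have "deg M = a" using M by (intro eq_of_subset_size) simp_all
  then show "(a, b) \<in> edge_sums" using M by (intro edge_sums_mem[of M]) simp_all
qed

section \<open>Normality in terms of halving edge sums\<close>

text \<open>Since \<open>size a = 2 * b\<close>, an inclusion in either direction is an equality;
  thus one criterion serves packings and coverings alike.\<close>

lemma half_closedI:
  assumes "\<And>a b M. set_mset M \<subseteq> arcs f \<Longrightarrow> a + a = deg M \<Longrightarrow> size M = 2 * b \<Longrightarrow> size a = 2 * b \<Longrightarrow>
    \<exists>N. set_mset N \<subseteq> arcs f \<and> size N = b \<and> (deg N \<subseteq># a \<or> a \<subseteq># deg N)"
  shows half_closed
  unfolding half_closed_def
proof (intro allI impI, elim conjE)
  fix a M assume M: "set_mset M \<subseteq> arcs f" "a + a = deg M" "even (size a)"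
  then obtain b where b: "size a = 2 * b" by blast
  then have "size M = 2 * b" using arg_cong[OF M(2), of size] by simp
  from assms[OF M(1,2) this b] obtain N
    where N: "set_mset N \<subseteq> arcs f" "size N = b" "deg N \<subseteq># a \<or> a \<subseteq># deg N"
    by (elim exE conjE)
  from N(3) have "a = deg N"
  proof
    assume "deg N \<subseteq># a"
    then have "deg N = a" by (rule eq_of_subset_size) (simp add: N b)
    then show ?thesis ..
  next
    assume "a \<subseteq># deg N"
    then show ?thesis by (rule eq_of_subset_size) (simp add: N b)
  qed
  with N(1) show "\<exists>N. set_mset N \<subseteq> arcs f \<and> a = deg N" by (intro exI[of _ N] conjI)
qed

text \<open>For necessity, the monomial with exponent (\<open>a\<close>, \<open>b\<close>) is a
  fraction whose denominator has degree 0 in \<open>t\<close>: multiplying by \<open>b\<close>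
  copies of an edge takes it into the Rees algebra.\<close>

lemma normal_edge_sums_above_iff:
  "normal_subring (monoid_algebra (expos edge_sums_above) :: ('n, 'k::field) mpoly poly set) \<longleftrightarrow> half_closed"
proof
  assume normal: "normal_subring (monoid_algebra (expos edge_sums_above) :: ('n, 'k) mpoly poly set)"
  show half_closed
  proof (rule half_closedI)
    fix a b M assume M: "set_mset M \<subseteq> arcs f" "a + a = deg M" "size M = 2 * b" "size a = 2 * b"
    obtain e where e: "e \<in> arcs f" using arc_exists by blast
    let ?R = "replicate_mset b e"
    have R: "set_mset ?R \<subseteq> arcs f" using e by (auto split: if_splits)
    have "(expo a, b) \<in> expos edge_sums_above"
    proof (rule normal_monoid_algebra_half[OF normal, where x = "(expo (a + deg ?R), b)" and y = "(expo (deg ?R), 0)"])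
      have "(deg ?R, 0) \<in> edge_sums_above" by (rule edge_sums_above_mem[of "{#}"]) simp_all
      then show "(expo (deg ?R), 0) \<in> expos edge_sums_above" by simp
      have "(a + deg ?R, b) \<in> edge_sums_above" using R
        by (intro edge_sums_above_mem[of ?R]) auto
      then show "(expo (a + deg ?R), b) \<in> expos edge_sums_above" unfolding expos_iff .
      show "(expo (a + deg ?R), b) = (expo a, b) + (expo (deg ?R), 0)" by simp
      have "(a + a, b + b) \<in> edge_sums_above" using M
        by (intro edge_sums_above_mem[of M]) auto
      then have "(expo (a + a), b + b) \<in> expos edge_sums_above" unfolding expos_iff .
      then show "(expo a, b) + (expo a, b) \<in> expos edge_sums_above" by simp
    qed
    then have "(a, b) \<in> edge_sums_above" unfolding expos_iff .
    from edge_sums_aboveE[OF this] obtain N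
      where "set_mset N \<subseteq> arcs f" "size N = b" "deg N \<subseteq># a" .
    then show "\<exists>N. set_mset N \<subseteq> arcs f \<and> size N = b \<and> (deg N \<subseteq># a \<or> a \<subseteq># deg N)"
      by (intro exI[of _ N]) simp
  qed
qed (rule normal_monoid_algebra[OF is_submonoid_edge_sums_above completely_closed_edge_sums_above])

text \<open>For necessity the denominator is a power of \<open>t\<close>: with \<open>size a\<close>
  further factors \<open>t\<close>, every vertex of \<open>a\<close> can have an edge of its
  own.\<close>

lemma normal_edge_sums_below_iff:
  "normal_subring (monoid_algebra (expos edge_sums_below) :: ('n, 'k::field) mpoly poly set) \<longleftrightarrow> half_closed"
proof
  assume normal: "normal_subring (monoid_algebra (expos edge_sums_below) :: ('n, 'k) mpoly poly set)"
  show half_closed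
  proof (rule half_closedI)
    fix a b M assume M: "set_mset M \<subseteq> arcs f" "a + a = deg M" "size M = 2 * b" "size a = 2 * b"
    obtain h where h: "\<And>u. (u, h u) \<in> arcs f" using arc_exists by metis
    \<comment> \<open>\<open>undefined\<close> stands for an arbitrary vertex; \<open>b\<close>
      copies of its arc merely bring the number of edges up to \<open>b + size a\<close>.\<close>
    let ?R = "image_mset (\<lambda>u. (u, h u)) a" and ?B = "replicate_mset b (undefined, h undefined)"
    have R: "set_mset ?R \<subseteq> arcs f" "set_mset (?R + ?B) \<subseteq> arcs f" using h by (auto split: if_splits)
    have "(expo a, b) \<in> expos edge_sums_below"
    proof (rule normal_monoid_algebra_half[OF normal, where x = "(expo a, b + size a)" and y = "(expo {#}, size a)"])
      have "({#} :: 'n multiset, size a) \<in> edge_sums_below"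
        using R by (intro edge_sums_below_mem[of ?R]) auto
      then show "(expo {#}, size a) \<in> expos edge_sums_below" unfolding expos_iff .
      have "a \<subseteq># deg (?R + ?B)"
        by (simp add: deg_def image_mset.compositionality comp_def union_assoc)
      then have "(a, b + size a) \<in> edge_sums_below"
        using R(2) by (intro edge_sums_below_mem[of "?R + ?B"]) simp_all
      then show "(expo a, b + size a) \<in> expos edge_sums_below" unfolding expos_iff .
      show "(expo a, b + size a) = (expo a, b) + (expo {#}, size a)" by simp
      have "(a + a, b + b) \<in> edge_sums_below" using M
        by (intro edge_sums_below_mem[of M]) auto
      then have "(expo (a + a), b + b) \<in> expos edge_sums_below" unfolding expos_iff .
      then show "(expo a, b) + (expo a, b) \<in> expos edge_sums_below" by simp
    qed
    then have "(a, b) \<in> edge_sums_below" unfolding expos_iff .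
    from edge_sums_belowE[OF this] obtain N
      where "set_mset N \<subseteq> arcs f" "size N = b" "a \<subseteq># deg N" .
    then show "\<exists>N. set_mset N \<subseteq> arcs f \<and> size N = b \<and> (deg N \<subseteq># a \<or> a \<subseteq># deg N)"
      by (intro exI[of _ N]) simp
  qed
qed (rule normal_monoid_algebra[OF is_submonoid_edge_sums_below completely_closed_edge_sums_below])

text \<open>For necessity, connectedness puts \<open>a\<close> into the lattice of edges, so the
  monomial is a quotient of two products of edges; comparing sizes shows that the exponents of
  \<open>t\<close> agree.\<close>

lemma normal_edge_sums_iff:
  assumes "connected_graph f"
  shows "normal_subring (monoid_algebra (expos edge_sums) :: ('n, 'k::field) mpoly poly set) \<longleftrightarrow> half_closed"
proof
  assume normal: "normal_subring (monoid_algebra (expos edge_sums) :: ('n, 'k) mpoly poly set)"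
  show half_closed
  proof (rule half_closedI)
    fix a b M assume M: "set_mset M \<subseteq> arcs f" "a + a = deg M" "size M = 2 * b" "size a = 2 * b"
    have "lattice_cong a {#}"
      using assms M by (intro half_in_lattice) (auto simp: connected_graph_def arcs_def)
    then obtain P Q where PQ: "set_mset P \<subseteq> arcs f" "set_mset Q \<subseteq> arcs f" "a + deg P = deg Q"
      unfolding lattice_cong_def by auto
    from arg_cong[OF PQ(3), of size] have "size Q = b + size P"
      unfolding size_union size_deg M(4) by simp
    have "(expo a, b) \<in> expos edge_sums"
    proof (rule normal_monoid_algebra_half[OF normal, where x = "(expo (deg Q), size Q)" and y = "(expo (deg P), size P)"])
      show "(expo (deg P), size P) \<in> expos edge_sums" "(expo (deg Q), size Q) \<in> expos edge_sums"
        unfolding expos_iff using PQ by (auto intro: edge_sums_mem)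
      show "(expo (deg Q), size Q) = (expo a, b) + (expo (deg P), size P)"
        using \<open>size Q = b + size P\<close> by (simp flip: PQ(3))
      have "(a + a, b + b) \<in> edge_sums" using M
        by (intro edge_sums_mem[of M]) auto
      then have "(expo (a + a), b + b) \<in> expos edge_sums" unfolding expos_iff .
      then show "(expo a, b) + (expo a, b) \<in> expos edge_sums" by simp
    qed
    then have "(a, b) \<in> edge_sums" unfolding expos_iff .
    from edge_sumsE[OF this] obtain N
      where "set_mset N \<subseteq> arcs f" "size N = b" "a = deg N" .
    then show "\<exists>N. set_mset N \<subseteq> arcs f \<and> size N = b \<and> (deg N \<subseteq># a \<or> a \<subseteq># deg N)"
      by (intro exI[of _ N]) simp
  qed
qed (rule normal_monoid_algebra[OF is_submonoid_edge_sums completely_closed_edge_sums])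

end

subsection \<open>The three algebras as monoid algebras\<close>

lemma Var_power: "Var i ^ n = (Poly_Mapping.single (Poly_Mapping.single i n) 1 :: ('v, 'k::field) mpoly)"
  by (induction n) (simp_all add: Var_def mult_single single_add[symmetric])

lemma monomial_eq: "monomial a = (Poly_Mapping.single (\<Sum>i\<in>UNIV. Poly_Mapping.single i (a $ i)) 1 :: ('v::finite, 'k::field) mpoly)"
proof -
  have "(\<Prod>i\<in>I. Var i ^ (a $ i)) = (Poly_Mapping.single (\<Sum>i\<in>I. Poly_Mapping.single i (a $ i)) 1 :: ('v, 'k) mpoly)" if "finite I" for I
    using that by (induction I) (simp_all add: Var_power mult_single)
  then show ?thesis by (simp add: monomial_def)
qed

lemma monomial_char_vec: "monomial (char_vec e) = Poly_Mapping.single (expo (mset_set e)) 1"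
proof -
  have "(\<Sum>i\<in>UNIV. Poly_Mapping.single i (char_vec e $ i)) = expo (mset_set e)"
    by (rule poly_mapping_eqI)
      (simp add: lookup_sum lookup_single when_def char_vec_def count_mset_set' flip: of_bool_def)
  then show ?thesis by (simp add: monomial_eq)
qed

lemma monoid_gen_subset:
  assumes "is_submonoid S" "G \<subseteq> S" shows "monoid_gen G \<subseteq> S"
proof
  fix x assume "x \<in> monoid_gen G"
  then show "x \<in> S" using assms unfolding is_submonoid_def by induction auto
qed

lemma size_filter_eq_sum: "size {#v \<in># W. v \<in> X#} = (\<Sum>i\<in>X. count W i)" for X :: "'v::finite set"
proof (induction W)
  case (add w W)
  have "(\<Sum>i\<in>X. count (add_mset w W) i) = (\<Sum>i\<in>X. (if w = i then 1 else 0) + count W i)"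
    by (intro sum.cong) auto
  also have "\<dots> = of_bool (w \<in> X) + (\<Sum>i\<in>X. count W i)"
    by (simp add: sum.distrib)
  finally show ?case using add by simp
qed simp

context graph
begin

lemma edge_sums_gen:
  "monoid_gen (range (\<lambda>k. (expo (mset_set (f k)), 1))) = expos edge_sums" (is "monoid_gen ?G = _")
proof
  show "monoid_gen ?G \<subseteq> expos edge_sums"
  proof (rule monoid_gen_subset[OF is_submonoid_edge_sums], clarify)
    fix k
    obtain u v where uv: "f k = {u, v}" "u \<noteq> v" "(u, v) \<in> arcs f" by (rule edge_obtain[of k])
    have "(mset_set (f k), 1) \<in> edge_sums"
      by (rule edge_sums_mem[of "{#(u, v)#}"]) (simp_all add: uv)
    then show "(expo (mset_set (f k)), 1) \<in> expos edge_sums" unfolding expos_iff .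
  qed
  show "expos edge_sums \<subseteq> monoid_gen ?G"
  proof clarify
    fix a b assume "(a, b) \<in> edge_sums"
    then obtain M where M: "set_mset M \<subseteq> arcs f" "size M = b" "a = deg M" by (rule edge_sumsE)
    have "(expo (deg M), size M) \<in> monoid_gen ?G"
      using M(1)
    proof (induction M)
      case empty
      then show ?case using monoid_gen.zero[of ?G] by (simp add: zero_prod_def)
    next
      case (add e M)
      obtain u v where e: "e = (u, v)" by (cases e)
      then obtain k where k: "f k = {u, v}" using add.prems by (auto simp: arcs_def)
      moreover have "u \<noteq> v" using add.prems irrefl e by auto
      ultimately have "(expo (mset_set (f k)), 1) + (expo (deg M), size M) = (expo (deg (add_mset e M)), size (add_mset e M))"
        by (simp add: e expo_add_mset add.assoc)
      moreover have "(expo (mset_set (f k)), 1) + (expo (deg M), size M) \<in> monoid_gen ?G"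
        by (rule monoid_gen.add) (use add in auto)
      ultimately show ?case by simp
    qed
    then show "(expo a, b) \<in> monoid_gen ?G" using M by simp
  qed
qed

lemma edge_sums_below_gen:
  "monoid_gen ({(0, 1)} \<union> range (\<lambda>i. (expo {#i#}, 1)) \<union> range (\<lambda>k. (expo (mset_set (f k)), 1))) = expos edge_sums_below"
  (is "monoid_gen ?G = _")
proof
  show "monoid_gen ?G \<subseteq> expos edge_sums_below"
  proof (rule monoid_gen_subset[OF is_submonoid_edge_sums_below], intro Un_least subsetI)
    obtain e where e: "e \<in> arcs f" using arc_exists by blast
    have "({#}, 1) \<in> edge_sums_below" by (rule edge_sums_below_mem[of "{#e#}"]) (simp_all add: e)
    then have "(expo {#}, 1) \<in> expos edge_sums_below" unfolding expos_iff .
    then show "x \<in> expos edge_sums_below" if "x \<in> {(0, 1)}" for x using that by simp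
  next
    fix x :: "('n \<Rightarrow>\<^sub>0 nat) \<times> nat" assume "x \<in> range (\<lambda>i. (expo {#i#}, 1))"
    then obtain i where x: "x = (expo {#i#}, 1)" by blast
    obtain j where j: "(i, j) \<in> arcs f" using arc_exists by blast
    have "({#i#}, 1) \<in> edge_sums_below" by (rule edge_sums_below_mem[of "{#(i, j)#}"]) (simp_all add: j)
    then show "x \<in> expos edge_sums_below" unfolding x expos_iff .
  next
    fix x :: "('n \<Rightarrow>\<^sub>0 nat) \<times> nat" assume "x \<in> range (\<lambda>k. (expo (mset_set (f k)), 1))"
    then obtain k where x: "x = (expo (mset_set (f k)), 1)" by blast
    obtain u v where uv: "f k = {u, v}" "u \<noteq> v" "(u, v) \<in> arcs f" by (rule edge_obtain[of k])
    have "(mset_set (f k), 1) \<in> edge_sums_below"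
      by (rule edge_sums_below_mem[of "{#(u, v)#}"]) (simp_all add: uv)
    then show "x \<in> expos edge_sums_below" unfolding x expos_iff .
  qed
  show "expos edge_sums_below \<subseteq> monoid_gen ?G"
  proof clarify
    fix a b assume "(a, b) \<in> edge_sums_below"
    then obtain M where M: "set_mset M \<subseteq> arcs f" "size M = b" "a \<subseteq># deg M" by (rule edge_sums_belowE)
    have "(expo a, size M) \<in> monoid_gen ?G"
      using M(1,3)
    proof (induction M arbitrary: a)
      case empty
      then show ?case using monoid_gen.zero[of ?G] by (simp add: zero_prod_def)
    next
      case (add e M)
      obtain u v where e: "e = (u, v)" by (cases e)
      then obtain k where k: "f k = {u, v}" using add.prems by (auto simp: arcs_def)
      have uv: "u \<noteq> v" using add.prems irrefl e by auto
      \<comment> \<open>The share of \<open>a\<close> assigned to this edge: nothing, one end or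
        both ends, which are the three kinds of generators.\<close>
      define c where "c = (if u \<in># a then {#u#} else {#}) + (if v \<in># a then {#v#} else {#})"
      have "mset_set (f k) = {#u, v#}" using uv by (simp add: k)
      then have edge: "(expo {#u, v#}, 1) \<in> ?G" by (metis UnI2 rangeI)
      have c: "(expo c, 1) \<in> ?G"
      proof (cases "u \<in># a \<and> v \<in># a")
        case True
        then show ?thesis using edge by (simp only: c_def if_True add_mset_add_single[of u "{#v#}"] union_commute)
      next
        case False
        then show ?thesis by (auto simp: c_def)
      qed
      have "a - {#u, v#} \<subseteq># deg M"
        using add.prems(2) e by (simp add: subset_eq_diff_conv del: diff_diff_add_mset)
      with add have "(expo (a - {#u, v#}), size M) \<in> monoid_gen ?G" by simp
      from monoid_gen.add[OF c this]
      have "(expo (c + (a - {#u, v#})), size (add_mset e M)) \<in> monoid_gen ?G" by simp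
      also have "c + (a - {#u, v#}) = a"
        by (rule multiset_eqI) (use uv in \<open>auto simp: c_def simp flip: count_greater_zero_iff\<close>)
      finally show ?case .
    qed
    then show "(expo a, b) \<in> monoid_gen ?G" using M by simp
  qed
qed

lemma edge_subring_eq:
  "edge_subring_t f = (monoid_algebra (expos edge_sums) :: ('n, 'k::field) mpoly poly set)"
proof -
  have "range (\<lambda>k. monom (monomial (char_vec (f k))) 1) =
      (mterm 1 ` range (\<lambda>k. (expo (mset_set (f k)), 1)) :: ('n, 'k) mpoly poly set)"
    by (simp add: monomial_char_vec image_image)
  then show ?thesis
    unfolding edge_subring_t_def edge_sums_gen[symmetric] subalgebra_gen_mterms[symmetric] by simp
qed

lemma extended_edge_subring_eq:
  "extended_edge_subring_t f = (monoid_algebra (expos edge_sums_below) :: ('n, 'k::field) mpoly poly set)"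
proof -
  have "{monom 1 1} \<union> range (\<lambda>i. monom (Var i) 1) \<union> range (\<lambda>k. monom (monomial (char_vec (f k))) 1) =
      (mterm 1 ` ({(0, 1)} \<union> range (\<lambda>i. (expo {#i#}, 1)) \<union> range (\<lambda>k. (expo (mset_set (f k)), 1)))
        :: ('n, 'k) mpoly poly set)"
    by (simp add: monomial_char_vec image_image image_Un Var_def expo_add_mset)
  then show ?thesis
    unfolding extended_edge_subring_t_def edge_sums_below_gen[symmetric] subalgebra_gen_mterms[symmetric] by simp
qed

lemma edge_sums_above_upward:
  assumes "(a, i) \<in> expos edge_sums_above" shows "(c + a, i) \<in> expos edge_sums_above"
proof -
  obtain a' c' where eq: "a = expo a'" "c = expo c'" using expo_surj by metis
  then have "(a', i) \<in> edge_sums_above" using assms by simp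
  then obtain M where M: "set_mset M \<subseteq> arcs f" "size M = i" "deg M \<subseteq># a'" by (rule edge_sums_aboveE)
  then have "(c' + a', i) \<in> edge_sums_above"
    by (intro edge_sums_above_mem[of M]) (auto intro: subset_mset.add_increasing)
  then show ?thesis using eq expos_iff[of "c' + a'" i] by simp
qed

text \<open>Powers of a monomial ideal are monomial: the polynomials all of whose exponents dominate
  a sum of \<open>i\<close> edges form an ideal, and splitting off one edge gives the induction on
  \<open>i\<close>.\<close>

lemma ideal_power_edge_ideal:
  "ideal_power (edge_ideal f :: ('n, 'k::field) mpoly set) i = {p. \<forall>a\<in>Poly_Mapping.keys p. (a, i) \<in> expos edge_sums_above}"
proof -
  interpret module "(*) :: ('n, 'k) mpoly \<Rightarrow> _"
    by unfold_locales (auto simp: algebra_simps)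
  define J :: "nat \<Rightarrow> ('n, 'k) mpoly set"
    where "J i = {p. \<forall>a\<in>Poly_Mapping.keys p. (a, i) \<in> expos edge_sums_above}" for i
  have subspace: "subspace (J i)" for i
  proof (rule subspaceI)
    show "0 \<in> J i" by (simp add: J_def)
    show "p + q \<in> J i" if "p \<in> J i" "q \<in> J i" for p q
      using that keys_add[of p q] by (auto simp: J_def)
    show "c * p \<in> J i" if "p \<in> J i" for c p
      unfolding J_def
    proof clarify
      fix a assume "a \<in> Poly_Mapping.keys (c * p)"
      then obtain x y where "a = x + y" "y \<in> Poly_Mapping.keys p" using keys_mult by blast
      then show "(a, i) \<in> expos edge_sums_above"
        using edge_sums_above_upward that unfolding J_def by blast
    qed
  qed
  have edge: "Poly_Mapping.single (expo {#u, v#}) 1 \<in> (edge_ideal f :: ('n, 'k) mpoly set)" if uv: "(u, v) \<in> arcs f" for u v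
  proof -
    obtain k where k: "f k = {u, v}" using uv by (auto simp: arcs_def)
    moreover have "u \<noteq> v" using uv irrefl by blast
    ultimately have "monomial (char_vec (f k)) = (Poly_Mapping.single (expo {#u, v#}) 1 :: ('n, 'k) mpoly)"
      by (simp add: monomial_char_vec)
    then show ?thesis unfolding edge_ideal_def ideal_gen_def by (metis rangeI span_base)
  qed
  have I: "edge_ideal f \<subseteq> J 1"
    unfolding edge_ideal_def ideal_gen_def
  proof (rule span_minimal[OF _ subspace], clarify)
    fix k
    obtain u v where uv: "f k = {u, v}" "u \<noteq> v" "(u, v) \<in> arcs f" by (rule edge_obtain[of k])
    have "(mset_set (f k), 1) \<in> edge_sums_above"
      by (rule edge_sums_above_mem[of "{#(u, v)#}"]) (simp_all add: uv)
    then have "(expo (mset_set (f k)), 1) \<in> expos edge_sums_above" unfolding expos_iff .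
    then show "monomial (char_vec (f k)) \<in> J 1" by (simp add: J_def monomial_char_vec)
  qed
  have "ideal_power (edge_ideal f) i = J i"
  proof (induction i)
    case 0
    have "(a, 0) \<in> expos edge_sums_above" for a
    proof -
      obtain a' where a: "a = expo a'" using expo_surj by blast
      have "(a', 0) \<in> edge_sums_above" by (rule edge_sums_above_mem[of "{#}"]) simp_all
      then show ?thesis unfolding a expos_iff .
    qed
    then show ?case by (simp add: J_def)
  next
    case (Suc i)
    show ?case unfolding ideal_power.simps ideal_gen_def
    proof
      show "span {a * b |a b. a \<in> edge_ideal f \<and> b \<in> ideal_power (edge_ideal f) i} \<subseteq> J (Suc i)"
      proof (rule span_minimal[OF _ subspace], clarify)
        fix p q :: "('n, 'k) mpoly" assume pq: "p \<in> edge_ideal f" "q \<in> ideal_power (edge_ideal f) i"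
        then have J: "p \<in> J 1" "q \<in> J i" using I Suc by auto
        show "p * q \<in> J (Suc i)" unfolding J_def
        proof clarify
          fix a assume "a \<in> Poly_Mapping.keys (p * q)"
          then obtain x y where xy: "a = x + y" "x \<in> Poly_Mapping.keys p" "y \<in> Poly_Mapping.keys q"
            using keys_mult by blast
          then have "(x, 1) + (y, i) \<in> expos edge_sums_above"
            using is_submonoid_edge_sums_above J unfolding is_submonoid_def J_def by blast
          then show "(a, Suc i) \<in> expos edge_sums_above" by (simp add: xy)
        qed
      qed
      show "J (Suc i) \<subseteq> span {a * b |a b. a \<in> edge_ideal f \<and> b \<in> ideal_power (edge_ideal f) i}" (is "_ \<subseteq> ?S")
      proof
        fix p assume p: "p \<in> J (Suc i)"
        have "Poly_Mapping.single a (Poly_Mapping.lookup p a) \<in> ?S" if "a \<in> Poly_Mapping.keys p" for a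
        proof -
          obtain a' where a: "a = expo a'" using expo_surj by blast
          have "(expo a', Suc i) \<in> expos edge_sums_above" using p that unfolding J_def a by blast
          then have "(a', Suc i) \<in> edge_sums_above" unfolding expos_iff .
          then obtain M where M: "set_mset M \<subseteq> arcs f" "size M = Suc i" "deg M \<subseteq># a'"
            by (rule edge_sums_aboveE)
          \<comment> \<open>One edge of \<open>M\<close> becomes the factor from the edge ideal; the
            other \<open>i\<close> edges and the surplus \<open>r\<close> form the factor from the
            \<open>i\<close>-th power.\<close>
          then obtain e N where N: "M = add_mset e N" by (metis size_eq_Suc_imp_eq_union)
          obtain u v where e: "e = (u, v)" by (cases e)
          have uv: "(u, v) \<in> arcs f" using M N e by simp
          have "{#u, v#} + deg N \<subseteq># a'" using M(3) N e by simp
          then obtain r where r: "a' = {#u, v#} + deg N + r" by (metis subset_mset.le_iff_add)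
          have "(deg N + r, i) \<in> edge_sums_above"
            by (rule edge_sums_above_mem[of N]) (use M N in auto)
          then have "(expo (deg N + r), i) \<in> expos edge_sums_above" unfolding expos_iff .
          then have "Poly_Mapping.single (expo (deg N + r)) (Poly_Mapping.lookup p a) \<in> J i"
            by (simp add: J_def)
          with edge[OF uv] Suc have "Poly_Mapping.single (expo {#u, v#}) 1 *
              Poly_Mapping.single (expo (deg N + r)) (Poly_Mapping.lookup p a) \<in> ?S"
            by (intro span_base) blast
          moreover have "expo {#u, v#} + expo (deg N + r) = a"
            unfolding a r expo_add[symmetric] by (simp only: add.assoc)
          ultimately show ?thesis by (simp only: mult_single mult_1)
        qed
        then have "(\<Sum>a\<in>Poly_Mapping.keys p. Poly_Mapping.single a (Poly_Mapping.lookup p a)) \<in> ?S"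
          by (intro span_sum)
        also have "(\<Sum>a\<in>Poly_Mapping.keys p. Poly_Mapping.single a (Poly_Mapping.lookup p a)) = p"
          by (rule poly_mapping_eqI)
            (auto simp: lookup_sum lookup_single when_def sum.delta in_keys_iff cong: if_cong)
        finally show "p \<in> ?S" .
      qed
    qed
  qed
  then show ?thesis by (simp add: J_def)
qed

lemma rees_algebra_eq:
  "rees_algebra (edge_ideal f) = (monoid_algebra (expos edge_sums_above) :: ('n, 'k::field) mpoly poly set)"
  unfolding rees_algebra_def monoid_algebra_def ideal_power_edge_ideal by simp

end

subsection \<open>The linear programs\<close>

definition multiplicities :: "'q::finite multiset \<Rightarrow> real ^ 'q" where
  "multiplicities B = (\<chi> k. real (count B k))"

lemma multiplicities_nth [simp]: "multiplicities B $ k = real (count B k)"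
  by (simp add: multiplicities_def)

lemma inner_one: "inner y 1 = (\<Sum>k\<in>UNIV. y $ k)" for y :: "real ^ 'q::finite"
  by (simp add: inner_vec_def)

lemma size_eq_sum_count: "size B = (\<Sum>k\<in>UNIV. count B k)" for B :: "'q::finite multiset"
  using size_filter_eq_sum[of UNIV B] by simp

lemma inner_multiplicities [simp]: "inner (multiplicities B) 1 = real (size B)"
  by (simp add: inner_one multiplicities_def size_eq_sum_count)

lemma nat_vector_multiplicities:
  assumes "\<forall>k. y $ k \<in> \<nat>" obtains B where "y = multiplicities B"
proof -
  have "\<exists>n. y $ k = real n" for k using assms by (auto elim: Nats_cases)
  then obtain g where g: "\<And>k. y $ k = real (g k)" by metis
  have "count (Abs_multiset g) = g" by (rule count_Abs_multiset) simp
  then have "y = multiplicities (Abs_multiset g)" by (simp add: vec_eq_iff multiplicities_def g)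
  then show thesis by (rule that)
qed

context graph
begin

abbreviation A where "A \<equiv> incidence_matrix f"

text \<open>The counterpart of \<open>deg\<close> for edges named by column index; as a vector it is
  the image of the multiplicities under \<open>A\<close>.\<close>

definition ends :: "'q multiset \<Rightarrow> 'n multiset" where
  "ends B = (\<Sum>k\<in>#B. mset_set (f k))"

lemma incidence_nth: "A $ i $ k = of_bool (i \<in> f k)"
  by (simp add: incidence_matrix_def char_vec_def)

lemma incidence_multiplicities: "(A *v multiplicities B) $ i = real (count (ends B) i)"
proof (induction B)
  case empty
  then show ?case by (simp add: multiplicities_def ends_def matrix_vector_mult_def)
next
  case (add b B)
  have "(A *v multiplicities (add_mset b B)) $ i =
      (\<Sum>k\<in>UNIV. (if k = b then of_bool (i \<in> f b) else 0) + A $ i $ k * multiplicities B $ k)"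
    unfolding matrix_vector_mult_def vec_lambda_beta
    by (intro sum.cong) (auto simp: multiplicities_def incidence_nth algebra_simps)
  also have "\<dots> = of_bool (i \<in> f b) + (A *v multiplicities B) $ i"
    by (simp add: sum.distrib matrix_vector_mult_def)
  also have "\<dots> = real (count (ends (add_mset b B)) i)"
    unfolding add by (simp add: ends_def count_mset_set')
  finally show ?case .
qed

lemma edge_sums_iff_ends: "(a, b) \<in> edge_sums \<longleftrightarrow> (\<exists>B. a = ends B \<and> b = size B)"
proof
  assume "(a, b) \<in> edge_sums"
  then obtain M where M: "set_mset M \<subseteq> arcs f" "size M = b" "a = deg M" by (rule edge_sumsE)
  have "\<exists>B. deg M = ends B \<and> size M = size B" using M(1)
  proof (induction M)
    case empty
    then show ?case by (intro exI[of _ "{#}"]) (simp add: ends_def)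
  next
    case (add e M)
    obtain u v where e: "e = (u, v)" by (cases e)
    obtain k where k: "f k = {u, v}" using add.prems e by (auto simp: arcs_def)
    have "u \<noteq> v" using add.prems irrefl e by auto
    obtain B where "deg M = ends B" "size M = size B" using add by auto
    then show ?case using \<open>u \<noteq> v\<close> k e by (intro exI[of _ "add_mset k B"]) (simp add: ends_def)
  qed
  then show "\<exists>B. a = ends B \<and> b = size B" using M by simp
next
  assume "\<exists>B. a = ends B \<and> b = size B"
  then obtain B where B: "a = ends B" "b = size B" by blast
  have "\<exists>M. set_mset M \<subseteq> arcs f \<and> size M = size B \<and> ends B = deg M"
  proof (induction B)
    case empty
    then show ?case by (intro exI[of _ "{#}"]) (simp add: ends_def)
  next
    case (add k B)
    obtain u v where uv: "f k = {u, v}" "u \<noteq> v" "(u, v) \<in> arcs f" by (rule edge_obtain[of k])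
    from add obtain M where "set_mset M \<subseteq> arcs f" "size M = size B" "ends B = deg M" by (elim exE conjE)
    then show ?case using uv by (intro exI[of _ "add_mset (u, v) M"]) (simp add: ends_def)
  qed
  then obtain M where "set_mset M \<subseteq> arcs f" "size M = size B" "ends B = deg M" by (elim exE conjE)
  then show "(a, b) \<in> edge_sums" unfolding B by (intro edge_sums_mem[of M])
qed

lemma sum_incidence_nth: "(\<Sum>i\<in>X. A $ i $ k) = (\<Sum>i\<in>f k. of_bool (i \<in> X))"
  by (simp add: incidence_nth of_bool_def sum.If_cases Int_commute)

lemma sum_incidence: "(\<Sum>i\<in>X. (A *v y) $ i) = (\<Sum>k\<in>UNIV. (\<Sum>i\<in>f k. of_bool (i \<in> X)) * y $ k)"
  unfolding sum_incidence_nth[symmetric]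
  by (simp add: matrix_vector_mult_def sum_distrib_right) (rule sum.swap)

lemma sum_incidence_UNIV: "(\<Sum>i\<in>UNIV. (A *v y) $ i) = 2 * inner y 1"
proof -
  have "(\<Sum>i\<in>f k. of_bool (i \<in> UNIV)) = (2 :: real)" for k
    using simple by (simp add: simple_graph_def)
  then show ?thesis unfolding sum_incidence inner_one by (simp add: sum_distrib_left)
qed

text \<open>Weak duality for real weights: both orientations of an edge are covered, so its ends
  count at least twice in \<open>X\<close> and \<open>Y\<close> together.\<close>

lemma inner_le_cover:
  assumes "0 \<le> y" "covers X Y"
  shows "2 * inner y 1 \<le> (\<Sum>i\<in>X. (A *v y) $ i) + (\<Sum>i\<in>Y. (A *v y) $ i)"
proof -
  have "2 * y $ k \<le> (\<Sum>i\<in>f k. of_bool (i \<in> X)) * y $ k + (\<Sum>i\<in>f k. of_bool (i \<in> Y)) * y $ k" for k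
  proof -
    obtain u v where uv: "f k = {u, v}" "u \<noteq> v" "(u, v) \<in> arcs f" by (rule edge_obtain[of k])
    have two: "(\<Sum>i\<in>f k. of_bool (i \<in> Z)) = (of_bool (u \<in> Z) + of_bool (v \<in> Z) :: real)" for Z
      by (simp add: uv(1,2))
    have "u \<in> X \<or> v \<in> Y" "v \<in> X \<or> u \<in> Y"
      using assms(2) uv(3) sym[OF uv(3)] unfolding covers_def by auto
    then have "2 \<le> (of_bool (u \<in> X) + of_bool (v \<in> X)) + (of_bool (u \<in> Y) + of_bool (v \<in> Y) :: real)"
      by auto
    moreover have "0 \<le> y $ k" using assms(1) by (simp add: less_eq_vec_def)
    ultimately have "2 * y $ k \<le> ((of_bool (u \<in> X) + of_bool (v \<in> X)) + (of_bool (u \<in> Y) + of_bool (v \<in> Y))) * y $ k"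
      by (rule mult_right_mono)
    then show ?thesis unfolding two by (simp only: distrib_right)
  qed
  then show ?thesis unfolding sum_incidence inner_one sum_distrib_left sum.distrib[symmetric]
    by (intro sum_mono)
qed

text \<open>The preceding bound in complementary form, since all entries of \<open>A *v y\<close>
  together sum to twice the value of \<open>y\<close>.\<close>

lemma inner_ge_cover:
  assumes "0 \<le> y" "covers X Y"
  shows "(\<Sum>i\<in>-X. (A *v y) $ i) + (\<Sum>i\<in>-Y. (A *v y) $ i) \<le> 2 * inner y 1"
proof -
  have "(\<Sum>i\<in>X. g i) + (\<Sum>i\<in>-X. g i) = (\<Sum>i\<in>UNIV. g i)" for X and g :: "'n \<Rightarrow> real"
    by (subst sum.union_disjoint[symmetric]) auto
  from this[of "\<lambda>i. (A *v y) $ i" X] this[of "\<lambda>i. (A *v y) $ i" Y] show ?thesis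
    using inner_le_cover[OF assms] unfolding sum_incidence_UNIV by linarith
qed

lemma incidence_nonneg: "0 \<le> y \<Longrightarrow> 0 \<le> (A *v y) $ i"
  by (auto simp: matrix_vector_mult_def incidence_nth less_eq_vec_def intro!: sum_nonneg)

lemma multiplicities_nonneg: "0 \<le> multiplicities B"
  by (simp add: multiplicities_def less_eq_vec_def)

text \<open>Half of each edge of \<open>M\<close> is a fractional weight that loads every vertex
  exactly as \<open>a\<close> does.\<close>

lemma half_vector:
  assumes "set_mset M \<subseteq> arcs f" "a + a = deg M" "size M = 2 * b"
  obtains y where "0 \<le> y" "inner y 1 = real b" "A *v y = (\<chi> i. real (count a i))"
proof -
  have "(deg M, size M) \<in> edge_sums" using assms(1) by (intro edge_sums_mem[of M]) simp_all
  then obtain B where B: "deg M = ends B" "size M = size B" unfolding edge_sums_iff_ends by blast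
  let ?y = "(1 / 2) *\<^sub>R multiplicities B"
  have "0 \<le> ?y" by (simp add: multiplicities_def less_eq_vec_def)
  moreover have "inner ?y 1 = real b" using B(2) assms(3) by simp
  moreover have "A *v ?y = (\<chi> i. real (count a i))"
  proof -
    have "(A *v ?y) $ i = real (count a i)" for i
    proof -
      have "(A *v ?y) $ i = (1 / 2) * real (count (ends B) i)"
        by (simp add: matrix_vector_mult_scaleR incidence_multiplicities)
      also have "\<dots> = real (count a i)" by (simp flip: B(1) assms(2))
      finally show ?thesis .
    qed
    then show ?thesis by (simp add: vec_eq_iff)
  qed
  ultimately show thesis by (rule that)
qed

lemma sum_count_eq_size: "(\<Sum>i\<in>UNIV. real (count a i)) = real (size a)" for a :: "'n multiset"
  by (simp add: size_eq_sum_count)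

text \<open>For necessity, \<open>a\<close> is the right-hand side: its size \<open>2 * b\<close>
  makes the half vector optimal with integral value \<open>b\<close>, so rounding yields
  \<open>b\<close> edges inside \<open>a\<close>. For sufficiency, the cover keeps the optimum less
  than 1 above an integral packing.\<close>

lemma integer_rounding_ge_one_iff: "integer_rounding_ge_one A \<longleftrightarrow> half_closed"
proof
  assume rounding: "integer_rounding_ge_one A"
  show half_closed
  proof (rule half_closedI)
    fix a b M assume M: "set_mset M \<subseteq> arcs f" "a + a = deg M" "size M = 2 * b" "size a = 2 * b"
    define w :: "(real, 'n) vec" where "w = (\<chi> i. real (count a i))"
    obtain y where y: "0 \<le> y" "inner y 1 = real b" "A *v y = w"
      unfolding w_def by (rule half_vector[OF M(1-3)])
    have "is_max_of {inner y 1 | y. 0 \<le> y \<and> A *v y \<le> w} (real b)"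
      unfolding is_max_of_def
    proof (intro conjI ballI)
      show "real b \<in> {inner y 1 | y. 0 \<le> y \<and> A *v y \<le> w}" using y by force
      fix s assume "s \<in> {inner y 1 | y. 0 \<le> y \<and> A *v y \<le> w}"
      then obtain x where x: "s = inner x 1" "A *v x \<le> w" by blast
      have "2 * s = (\<Sum>i\<in>UNIV. (A *v x) $ i)" by (simp add: sum_incidence_UNIV x)
      also have "\<dots> \<le> (\<Sum>i\<in>UNIV. w $ i)" using x(2) by (intro sum_mono) (simp add: less_eq_vec_def)
      also have "\<dots> = 2 * real b" using M(4) by (simp add: w_def sum_count_eq_size)
      finally show "s \<le> real b" by simp
    qed
    moreover have "\<forall>i. w $ i \<in> \<int>" by (simp add: w_def)
    ultimately have "is_max_of {inner y 1 | y. A *v y \<le> w \<and> (\<forall>k. y $ k \<in> \<nat>)} (of_int \<lfloor>real b\<rfloor>)"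
      using rounding unfolding integer_rounding_ge_one_def by blast
    then obtain x where x: "real b = inner x 1" "A *v x \<le> w" "\<forall>k. x $ k \<in> \<nat>"
      unfolding is_max_of_def by auto
    obtain B where B: "x = multiplicities B" using nat_vector_multiplicities[OF x(3)] .
    have "(ends B, size B) \<in> edge_sums" unfolding edge_sums_iff_ends by blast
    then obtain N where N: "set_mset N \<subseteq> arcs f" "size N = size B" "ends B = deg N" by (rule edge_sumsE)
    have "real (count (ends B) i) \<le> real (count a i)" for i
      using x(2) by (simp add: less_eq_vec_def w_def B incidence_multiplicities)
    then have "deg N \<subseteq># a" unfolding N(3)[symmetric] by (intro mset_subset_eqI) simp
    moreover have "size N = b" using x(1) N(2) by (simp add: B)
    ultimately show "\<exists>N. set_mset N \<subseteq> arcs f \<and> size N = b \<and> (deg N \<subseteq># a \<or> a \<subseteq># deg N)"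
      using N(1) by (intro exI[of _ N]) simp
  qed
next
  assume half: half_closed
  show "integer_rounding_ge_one A"
    unfolding integer_rounding_ge_one_def
  proof (intro allI impI)
    fix w :: "(real, 'n) vec" and m
    assume int: "\<forall>i. w $ i \<in> \<int>" and max: "is_max_of {inner y 1 | y. 0 \<le> y \<and> A *v y \<le> w} m"
    obtain y where y: "m = inner y 1" "0 \<le> y" "A *v y \<le> w"
      using max unfolding is_max_of_def by blast
    have le: "inner y 1 \<le> m" if "0 \<le> y" "A *v y \<le> w" for y
      using max that unfolding is_max_of_def by blast
    \<comment> \<open>The feasible \<open>y\<close> forces \<open>w\<close> to be nonnegative, so
      \<open>nat\<close> loses nothing.\<close>
    define W where "W = Abs_multiset (\<lambda>i. nat \<lfloor>w $ i\<rfloor>)"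
    have cW: "count W = (\<lambda>i. nat \<lfloor>w $ i\<rfloor>)" unfolding W_def by (rule count_Abs_multiset) simp
    have w: "w $ i = real (count W i)" for i
    proof -
      have "0 \<le> w $ i" using incidence_nonneg[OF y(2), of i] y(3) by (simp add: less_eq_vec_def order_trans)
      moreover obtain n where "w $ i = of_int n" using int by (meson Ints_cases)
      ultimately show ?thesis by (simp add: cW)
    qed
    obtain N X Y where N: "set_mset N \<subseteq> arcs f" "deg N \<subseteq># W" "covers X Y"
      "size {#u \<in># W. u \<in> X#} + size {#u \<in># W. u \<in> Y#} \<le> 2 * size N + 1"
      using matching_cover[OF half, of W] by metis
    have "(deg N, size N) \<in> edge_sums" using N(1) by (intro edge_sums_mem[of N]) simp_all
    then obtain B where B: "deg N = ends B" "size N = size B" unfolding edge_sums_iff_ends by blast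
    have Bw: "A *v multiplicities B \<le> w"
      using N(2) by (simp add: less_eq_vec_def w incidence_multiplicities mset_subset_eq_count flip: B(1))
    have "2 * m \<le> (\<Sum>i\<in>X. (A *v y) $ i) + (\<Sum>i\<in>Y. (A *v y) $ i)"
      unfolding y(1) using inner_le_cover[OF y(2) N(3)] .
    also have "\<dots> \<le> (\<Sum>i\<in>X. w $ i) + (\<Sum>i\<in>Y. w $ i)"
      using y(3) by (intro add_mono sum_mono) (simp_all add: less_eq_vec_def)
    also have "\<dots> = real (size {#u \<in># W. u \<in> X#} + size {#u \<in># W. u \<in> Y#})"
      by (simp add: w size_filter_eq_sum)
    also have "\<dots> \<le> real (2 * size N + 1)" using N(4) by (rule of_nat_mono)
    \<comment> \<open>In fact \<open>2 * m <= 2 * size N + 1\<close>, so the optimum exceeds the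
      integral value by at most one half.\<close>
    finally have "m < real (size B) + 1" by (simp add: B(2))
    moreover have "real (size B) \<le> m" using le[OF multiplicities_nonneg Bw] by simp
    ultimately have floor: "\<lfloor>m\<rfloor> = int (size B)" by (intro floor_unique) simp_all
    show "is_max_of {inner y 1 | y. A *v y \<le> w \<and> (\<forall>k. y $ k \<in> \<nat>)} (of_int \<lfloor>m\<rfloor>)"
      unfolding is_max_of_def
    proof (intro conjI ballI)
      show "of_int \<lfloor>m\<rfloor> \<in> {inner y 1 | y. A *v y \<le> w \<and> (\<forall>k. y $ k \<in> \<nat>)}"
        using Bw by (intro CollectI exI[of _ "multiplicities B"]) (simp add: floor)
      fix s assume "s \<in> {inner y 1 | y. A *v y \<le> w \<and> (\<forall>k. y $ k \<in> \<nat>)}"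
      then obtain x where x: "s = inner x 1" "A *v x \<le> w" "\<forall>k. x $ k \<in> \<nat>" by blast
      obtain C where C: "x = multiplicities C" using nat_vector_multiplicities[OF x(3)] .
      have "real (size C) \<le> m" using le[OF multiplicities_nonneg, of C] x C by simp
      then have "int (size C) \<le> \<lfloor>m\<rfloor>" by (simp add: le_floor_iff)
      then show "s \<le> of_int \<lfloor>m\<rfloor>" by (simp add: x(1) C floor)
    qed
  qed
qed

text \<open>The covering analogue: the half vector is optimal because it loads \<open>a\<close>
  exactly, and an integral solution of value \<open>b\<close> covers \<open>a\<close> with no vertex
  to spare.\<close>

lemma integer_rounding_le_one_iff: "integer_rounding_le_one A \<longleftrightarrow> half_closed"
proof
  assume rounding: "integer_rounding_le_one A"
  show half_closed
  proof (rule half_closedI)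
    fix a b M assume M: "set_mset M \<subseteq> arcs f" "a + a = deg M" "size M = 2 * b" "size a = 2 * b"
    define w :: "(real, 'n) vec" where "w = (\<chi> i. real (count a i))"
    obtain y where y: "0 \<le> y" "inner y 1 = real b" "A *v y = w"
      unfolding w_def by (rule half_vector[OF M(1-3)])
    have "is_min_of {inner y 1 | y. 0 \<le> y \<and> A *v y \<ge> w} (real b)"
      unfolding is_min_of_def
    proof (intro conjI ballI)
      show "real b \<in> {inner y 1 | y. 0 \<le> y \<and> A *v y \<ge> w}" using y by force
      fix s assume "s \<in> {inner y 1 | y. 0 \<le> y \<and> A *v y \<ge> w}"
      then obtain x where x: "s = inner x 1" "w \<le> A *v x" by blast
      have "2 * real b = (\<Sum>i\<in>UNIV. w $ i)" using M(4) by (simp add: w_def sum_count_eq_size)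
      also have "\<dots> \<le> (\<Sum>i\<in>UNIV. (A *v x) $ i)" using x(2) by (intro sum_mono) (simp add: less_eq_vec_def)
      also have "\<dots> = 2 * s" by (simp add: sum_incidence_UNIV x)
      finally show "real b \<le> s" by simp
    qed
    moreover have "\<forall>i. w $ i \<in> \<int>" by (simp add: w_def)
    ultimately have "is_min_of {inner y 1 | y. A *v y \<ge> w \<and> (\<forall>k. y $ k \<in> \<nat>)} (of_int \<lceil>real b\<rceil>)"
      using rounding unfolding integer_rounding_le_one_def by blast
    then obtain x where x: "real b = inner x 1" "w \<le> A *v x" "\<forall>k. x $ k \<in> \<nat>"
      unfolding is_min_of_def by auto
    obtain B where B: "x = multiplicities B" using nat_vector_multiplicities[OF x(3)] .
    have "(ends B, size B) \<in> edge_sums" unfolding edge_sums_iff_ends by blast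
    then obtain N where N: "set_mset N \<subseteq> arcs f" "size N = size B" "ends B = deg N" by (rule edge_sumsE)
    have "real (count a i) \<le> real (count (ends B) i)" for i
      using x(2) by (simp add: less_eq_vec_def w_def B incidence_multiplicities)
    then have "a \<subseteq># deg N" unfolding N(3)[symmetric] by (intro mset_subset_eqI) simp
    moreover have "size N = b" using x(1) N(2) by (simp add: B)
    ultimately show "\<exists>N. set_mset N \<subseteq> arcs f \<and> size N = b \<and> (deg N \<subseteq># a \<or> a \<subseteq># deg N)"
      using N(1) by (intro exI[of _ N]) simp
  qed
next
  assume half: half_closed
  show "integer_rounding_le_one A"
    unfolding integer_rounding_le_one_def
  proof (intro allI impI)
    fix \<alpha> :: "(real, 'n) vec" and m
    assume int: "\<forall>i. \<alpha> $ i \<in> \<int>" and min: "is_min_of {inner y 1 | y. 0 \<le> y \<and> A *v y \<ge> \<alpha>} m"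
    obtain y where y: "m = inner y 1" "0 \<le> y" "\<alpha> \<le> A *v y"
      using min unfolding is_min_of_def by blast
    have le: "m \<le> inner y 1" if "0 \<le> y" "\<alpha> \<le> A *v y" for y
      using min that unfolding is_min_of_def by blast
    \<comment> \<open>Negative entries of \<open>\<alpha>\<close> become 0. As \<open>A *v y\<close>
      is nonnegative for nonnegative \<open>y\<close>, this leaves the feasible set
      unchanged.\<close>
    define W where "W = Abs_multiset (\<lambda>i. nat \<lfloor>\<alpha> $ i\<rfloor>)"
    have cW: "count W = (\<lambda>i. nat \<lfloor>\<alpha> $ i\<rfloor>)" unfolding W_def by (rule count_Abs_multiset) simp
    have W: "real (count W i) = max 0 (\<alpha> $ i)" for i
    proof -
      obtain n where "\<alpha> $ i = of_int n" using int by (meson Ints_cases)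
      then show ?thesis by (cases "0 \<le> n") (simp_all add: cW)
    qed
    have Wy: "real (count W i) \<le> (A *v y) $ i" for i
      using incidence_nonneg[OF y(2), of i] y(3) by (simp add: W less_eq_vec_def)
    obtain N X Y where N: "set_mset N \<subseteq> arcs f" "W \<subseteq># deg N" "covers X Y"
      "2 * size N + size {#u \<in># W. u \<in> X#} + size {#u \<in># W. u \<in> Y#} \<le> 2 * size W + 1"
      using cover_matching[OF half arc_exists, of W] by metis
    have "(deg N, size N) \<in> edge_sums" using N(1) by (intro edge_sums_mem[of N]) simp_all
    then obtain B where B: "deg N = ends B" "size N = size B" unfolding edge_sums_iff_ends by blast
    have B\<alpha>: "\<alpha> \<le> A *v multiplicities B"
      unfolding less_eq_vec_def
    proof
      fix i
      have "\<alpha> $ i \<le> real (count W i)" by (simp add: W)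
      also have "\<dots> \<le> real (count (ends B) i)"
        using N(2) by (simp add: mset_subset_eq_count flip: B(1))
      finally show "\<alpha> $ i \<le> (A *v multiplicities B) $ i" by (simp add: incidence_multiplicities)
    qed
    have compl: "size W = size {#u \<in># W. u \<in> Z#} + size {#u \<in># W. u \<in> - Z#}" for Z
      unfolding Compl_iff size_union[symmetric] by (rule arg_cong[OF multiset_partition])
    \<comment> \<open>Passing to complements makes the bound on \<open>N\<close> comparable with the
      lower bound that \<open>inner_ge_cover\<close> gives for the fractional optimum.\<close>
    have "2 * size N \<le> size {#u \<in># W. u \<in> - X#} + size {#u \<in># W. u \<in> - Y#} + 1"
      using N(4) compl[of X] compl[of Y] by linarith
    then have "2 * real (size N) \<le> real (size {#u \<in># W. u \<in> - X#} + size {#u \<in># W. u \<in> - Y#}) + 1"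
      by linarith
    also have "\<dots> = (\<Sum>i\<in>-X. real (count W i)) + (\<Sum>i\<in>-Y. real (count W i)) + 1"
      unfolding size_filter_eq_sum by simp
    also have "\<dots> \<le> (\<Sum>i\<in>-X. (A *v y) $ i) + (\<Sum>i\<in>-Y. (A *v y) $ i) + 1"
      using Wy by (intro add_mono sum_mono) simp_all
    also have "\<dots> \<le> 2 * m + 1"
      using inner_ge_cover[OF y(2) N(3)] by (simp add: y(1))
    \<comment> \<open>Here \<open>2 * size N <= 2 * m + 1\<close>, so the integral covering exceeds
      the optimum by at most one half.\<close>
    finally have "real (size B) - 1 < m" by (simp add: B(2))
    moreover have "m \<le> real (size B)" using le[OF multiplicities_nonneg B\<alpha>] by simp
    ultimately have ceil: "\<lceil>m\<rceil> = int (size B)" by (intro ceiling_unique) simp_all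
    show "is_min_of {inner y 1 | y. A *v y \<ge> \<alpha> \<and> (\<forall>k. y $ k \<in> \<nat>)} (of_int \<lceil>m\<rceil>)"
      unfolding is_min_of_def
    proof (intro conjI ballI)
      show "of_int \<lceil>m\<rceil> \<in> {inner y 1 | y. A *v y \<ge> \<alpha> \<and> (\<forall>k. y $ k \<in> \<nat>)}"
        using B\<alpha> by (intro CollectI exI[of _ "multiplicities B"]) (simp add: ceil)
      fix s assume "s \<in> {inner y 1 | y. A *v y \<ge> \<alpha> \<and> (\<forall>k. y $ k \<in> \<nat>)}"
      then obtain x where x: "s = inner x 1" "\<alpha> \<le> A *v x" "\<forall>k. x $ k \<in> \<nat>" by blast
      obtain C where C: "x = multiplicities C" using nat_vector_multiplicities[OF x(3)] .
      have "m \<le> real (size C)" using le[OF multiplicities_nonneg, of C] x C by simp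
      then have "\<lceil>m\<rceil> \<le> int (size C)" by (simp add: ceiling_le_iff)
      then show "of_int \<lceil>m\<rceil> \<le> s" by (simp add: x(1) C ceil)
    qed
  qed
qed

end

theorem theorem3p3:
  fixes f :: "'q::finite \<Rightarrow> 'n::{finite,linorder} set"
    and A :: "real ^ 'q ^ 'n::{finite,linorder}"
    and I :: "('n::{finite,linorder}, 'k::field) mpoly set"
  assumes "simple_graph f" and "no_isolated_vertices f" and "connected_graph f"
    and "A = incidence_matrix f"
    and "I = edge_ideal f"
  shows "(integer_rounding_ge_one A \<longleftrightarrow> normal_subring (rees_algebra I))
       \<and> (normal_subring (rees_algebra I) \<longleftrightarrow>
            normal_subring (edge_subring_t f :: ('n, 'k) mpoly poly set))
       \<and> (normal_subring (edge_subring_t f :: ('n, 'k) mpoly poly set) \<longleftrightarrow>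
            normal_subring (extended_edge_subring_t f :: ('n, 'k) mpoly poly set))
       \<and> (integer_rounding_le_one A \<longleftrightarrow> integer_rounding_ge_one A)"
proof -
  interpret graph f using assms(1,2) by unfold_locales
  \<comment> \<open>All five conditions rewrite to \<open>half_closed\<close>; connectedness enters
    through the edge subring.\<close>
  show ?thesis
    unfolding assms(4,5) rees_algebra_eq edge_subring_eq extended_edge_subring_eq
      integer_rounding_ge_one_iff integer_rounding_le_one_iff
      normal_edge_sums_above_iff normal_edge_sums_below_iff normal_edge_sums_iff[OF assms(3)]
    by simp
qed

end
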